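(* Let $f\in C_b^2(\mathbb{R}^d)$. Then, for any $x\in\mathbb{R}^d$, the mapping $t\mapsto \mathcal{L}_0(P_tf)(x)$ is continuous on $[0,+\infty)$ and $\lim_{t\to0^+}\mathcal{L}_0(P_tf)(x)=\mathcal{L}_0f(x)$. Moreover, $$P_tf(x)=f(x)+\int_0^t\mathcal{L}_0(P_sf)(x)\,ds,\qquad t\ge0,\ x\in\mathbb{R}^d .$$
   Context: Let $d\ge1$, let $A$ be a real $d\times d$ matrix (with transpose $A^*$), $Q$ a real symmetric non-negative definite $d\times d$ matrix, $a\in\mathbb{R}^d$, and $\nu$ a $\sigma$-finite Borel measure on $\mathbb{R}^d$ with $\nu(\{0\})=0$ and $\int_{\mathbb{R}^d}(1\wedge|y|^2)\,\nu(dy)<\infty$ (no moment condition on $\nu$ at infinity is assumed). $C_b^2(\mathbb{R}^d)$ is the space of bounded continuous $f:\mathbb{R}^d\to\mathbb{R}$ that are twice differentiable with first and second derivatives bounded and continuous on $\mathbb{R}^d$. For $f\in C_b^2(\mathbb{R}^d)$ and $x\in\mathbb{R}^d$, the Ornstein--Uhlenbeck operator is $$\mathcal{L}_0f(x)=\tfrac12\mathrm{Tr}(QD^2f(x))+\langle a,Df(x)\rangle+\langle Ax,Df(x)\rangle+\int_{\mathbb{R}^d}\big(f(x+y)-f(x)-\mathbf{1}_{\{|y|\le1\}}\langle y,Df(x)\rangle\big)\,\nu(dy).$$ Let $Z=(Z_t)_{t\ge0}$ be a $d$-dimensional Lévy process with $\mathbb{E}[e^{i\langle u,Z_t\rangle}]=e^{-t\psi(u)}$,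 where $$\psi(u)=\tfrac12\langle Qu,u\rangle-i\langle a,u\rangle-\int_{\mathbb{R}^d}\big(e^{i\langle u,y\rangle}-1-i\langle u,y\rangle\mathbf{1}_{\{|y|\le1\}}\big)\,\nu(dy),\quad u\in\mathbb{R}^d.$$ The Ornstein--Uhlenbeck process is $X^x_t=e^{tA}x+Y_t$ with $Y_t=\int_0^te^{(t-s)A}\,dZ_s$ (the solution of $dX_t=AX_t\,dt+dZ_t$, $X_0=x$). The law $\mu_t$ of $Y_t$ is the Borel probability measure with characteristic function $\hat\mu_t(h)=\exp\big(-\int_0^t\psi(e^{sA^*}h)\,ds\big)$, $h\in\mathbb{R}^d$. The Ornstein--Uhlenbeck semigroup is, for $f:\mathbb{R}^d\to\mathbb{R}$ bounded and Borel, $$P_tf(x)=\mathbb{E}[f(X^x_t)]=\int_{\mathbb{R}^d}f(e^{tA}x+y)\,\mu_t(dy),\quad t\ge0,\ x\in\mathbb{R}^d.$$ For $f\in C_b^2(\mathbb{R}^d)$ one has $P_tf\in C_b^2(\mathbb{R}^d)$, so $\mathcal{L}_0(P_tf)$ makes sense. *)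

theory Defs
  imports "HOL-Probability.Probability"
begin

(* The componentwise ring structure on vectors also applies to real^'n^'n, so neither ^ nor exp
   refers to the matrix product; powers and the exponential are therefore defined via **. *)

primrec matrix_power :: "real^'n^'n \<Rightarrow> nat \<Rightarrow> real^'n^'n" where
  "matrix_power A 0 = mat 1"
| "matrix_power A (Suc k) = A ** matrix_power A k"

definition matrix_exp :: "real^'n^'n \<Rightarrow> real^'n^'n" where
  "matrix_exp A = (\<Sum>k. (1 / fact k) *\<^sub>R matrix_power A k)"

definition gradient :: "(real^'n \<Rightarrow> real) \<Rightarrow> real^'n \<Rightarrow> real^'n" where
  "gradient f x = (\<chi> i. frechet_derivative f (at x) (axis i 1))"

definition hessian :: "(real^'n \<Rightarrow> real) \<Rightarrow> real^'n \<Rightarrow> real^'n^'n" where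
  "hessian f x = jacobian (gradient f) (at x)"

definition Cb2 :: "(real^'n \<Rightarrow> real) set" where
  "Cb2 = {f.
     continuous_on UNIV f \<and> bounded (range f) \<and>
     (\<forall>x. f differentiable (at x)) \<and>
     continuous_on UNIV (gradient f) \<and> bounded (range (gradient f)) \<and>
     (\<forall>x. gradient f differentiable (at x)) \<and>
     continuous_on UNIV (hessian f) \<and> bounded (range (hessian f))}"

definition symmetric_nonneg_definite :: "real^'n^'n \<Rightarrow> bool" where
  "symmetric_nonneg_definite Q \<longleftrightarrow> transpose Q = Q \<and> (\<forall>u. 0 \<le> (Q *v u) \<bullet> u)"

definition levy_measure :: "(real^'n) measure \<Rightarrow> bool" where
  "levy_measure \<nu> \<longleftrightarrow> sets \<nu> = sets borel \<and> sigma_finite_measure \<nu> \<and> emeasure \<nu> {0} = 0 \<and>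
     (\<integral>\<^sup>+ y. ennreal (min 1 ((norm y)\<^sup>2)) \<partial>\<nu>) < \<infinity>"

definition OU_operator ::
  "real^'n^'n \<Rightarrow> real^'n^'n \<Rightarrow> real^'n \<Rightarrow> (real^'n) measure \<Rightarrow> (real^'n \<Rightarrow> real) \<Rightarrow> real^'n \<Rightarrow> real" where
  "OU_operator A Q a \<nu> f x =
     1/2 * trace (Q ** hessian f x) + a \<bullet> gradient f x + (A *v x) \<bullet> gradient f x +
     (LINT y|\<nu>. f (x + y) - f x - indicator {y. norm y \<le> 1} y * (y \<bullet> gradient f x))"

definition levy_exponent ::
  "real^'n^'n \<Rightarrow> real^'n \<Rightarrow> (real^'n) measure \<Rightarrow> real^'n \<Rightarrow> complex" where
  "levy_exponent Q a \<nu> u =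
     complex_of_real (1/2 * ((Q *v u) \<bullet> u)) - \<i> * complex_of_real (a \<bullet> u) -
     (CLINT y|\<nu>. iexp (u \<bullet> y) - 1 -
        \<i> * complex_of_real (u \<bullet> y) * indicator {y. norm y \<le> 1} y)"

(* The law of the stochastic convolution of exp ((t - s) A) with dZ_s over [0, t], where Z is the
   Levy process with exponent levy_exponent Q a \<nu>.  It enters through its characteristic function,
   which determines a Borel probability measure on real^'n uniquely. *)

definition OU_law ::
  "real^'n^'n \<Rightarrow> real^'n^'n \<Rightarrow> real^'n \<Rightarrow> (real^'n) measure \<Rightarrow> real \<Rightarrow> (real^'n) measure \<Rightarrow> bool" where
  "OU_law A Q a \<nu> t \<mu> \<longleftrightarrow> prob_space \<mu> \<and> sets \<mu> = sets borel \<and>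
     (\<forall>h. (CLINT y|\<mu>. iexp (h \<bullet> y)) =
        exp (- integral {0..t} (\<lambda>s. levy_exponent Q a \<nu> (matrix_exp (s *\<^sub>R transpose A) *v h))))"

definition OU_semigroup ::
  "real^'n^'n \<Rightarrow> (real \<Rightarrow> (real^'n) measure) \<Rightarrow> real \<Rightarrow> (real^'n \<Rightarrow> real) \<Rightarrow> real^'n \<Rightarrow> real" where
  "OU_semigroup A \<mu> t f x = (LINT y|\<mu> t. f (matrix_exp (t *\<^sub>R A) *v x + y))"

end

theory Submission
  imports Defs "HOL-Real_Asymp.Real_Asymp"
begin

text \<open>
For the waves \<open>x \<mapsto> Re (w exp (i u \<bullet> x))\<close> the semigroup is explicit through the characteristic function
of \<open>\<mu> t\<close>, and the evolution identity reduces to the fundamental theorem of calculus. For fixed \<open>t\<close>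
and \<open>x\<close> both sides of the identity are linear in \<open>f\<close> and continuous under pointwise convergence
of uniformly bounded 2-jets, so it remains to reach every \<open>C\<^sub>b\<^sup>2\<close> function from waves by such limits.
The powers \<open>q (z / sqrt n) ^ n\<close>, where \<open>q z\<close> is the mean of the \<open>cos (sqrt d * z\<^sub>i)\<close>, are trigonometric
polynomials whose 2-jets are bounded uniformly in \<open>n\<close> and converge to that of a Gaussian; hence the
identity holds for convolutions of integrable functions with Gaussians, then for integrable \<open>C\<^sub>b\<^sup>2\<close>
functions by mollification, and finally for all \<open>C\<^sub>b\<^sup>2\<close> functions by a Gaussian cut-off.

The identity makes \<open>P\<^sub>t f\<close> continuous in \<open>t\<close> for these \<open>f\<close>. Applied to wide Gaussians it yields the
tightness needed to extend this to all bounded continuous functions, in particular to the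
derivatives of \<open>f\<close>, and continuity of \<open>L (P\<^sub>t f) x\<close> follows by dominated convergence.
\<close>

section \<open>The matrix exponential\<close>

text \<open>The generator is applied after the semigroup because \<open>L f\<close> is unbounded in
  general: the drift term grows linearly in x while \<open>\<mu> t\<close> need not have moments, so
  integrating \<open>L f\<close> against \<open>\<mu> t\<close> may be meaningless. In
  \<open>L (P t f) x\<close> the drift is taken at the fixed point x, and all estimates are made at
  fixed x, linearly in the jet constant. The laws are known only through characteristic functions,
  one time at a time, so no path argument and no regularity in t is given beforehand; both are
  replaced by what the identity on waves provides. One bound for all 2-jets of an approximating
  sequence is indispensable, since dominated convergence is used three times: for the jump integral,
  where small jumps cost a second derivative, for \<open>\<mu> s\<close>, and for the time integral.
  This dictates the power kernel: the factors of order n produced by differentiation are absorbed by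
  |grad q|^2 + q^2 \<le> 1. Time continuity cannot stop at functions satisfying the identity: the
  Hessian of f is merely bounded and continuous, yet its image under the semigroup has to be
  continuous in t.\<close>

lemma bounded_bilinear_matrix_vector_mult:
  "bounded_bilinear ((*v) :: real^'n^'m \<Rightarrow> real^'n \<Rightarrow> real^'m)"
proof -
  have "bilinear ((*v) :: real^'n^'m \<Rightarrow> real^'n \<Rightarrow> real^'m)"
    unfolding bilinear_def
    by (auto intro!: linearI simp: matrix_vector_mult_add_rdistrib matrix_vector_right_distrib
        scaleR_matrix_vector_assoc[symmetric] matrix_vector_mult_scaleR)
  thus ?thesis by (simp add: bilinear_conv_bounded_bilinear)
qed

lemma bounded_bilinear_matrix_matrix_mult:
  "bounded_bilinear ((**) :: real^'n^'m \<Rightarrow> real^'k^'n \<Rightarrow> real^'k^'m)"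
proof -
  have "bilinear ((**) :: real^'n^'m \<Rightarrow> real^'k^'n \<Rightarrow> real^'k^'m)"
    unfolding bilinear_def
    by (auto intro!: linearI simp: matrix_matrix_mult_def vec_eq_iff sum.distrib algebra_simps sum_distrib_left)
  thus ?thesis by (simp add: bilinear_conv_bounded_bilinear)
qed

lemma bounded_linear_transpose: "bounded_linear (transpose :: real^'n^'m \<Rightarrow> real^'m^'n)"
  unfolding linear_conv_bounded_linear[symmetric]
  by (rule linearI) (auto simp: transpose_def vec_eq_iff)

lemma norm_transpose: "norm (transpose A) = norm (A :: real^'n^'m)"
proof -
  have "(\<Sum>i\<in>UNIV. \<Sum>j\<in>UNIV. (A $ j $ i)\<^sup>2) = (\<Sum>i\<in>UNIV. \<Sum>j\<in>UNIV. (A $ i $ j)\<^sup>2)"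
    by (rule sum.swap)
  thus ?thesis
    by (simp add: norm_vec_def L2_set_def sum_nonneg transpose_def)
qed

lemma norm_matrix_vector_mult_le: "norm (A *v x) \<le> norm (A :: real^'n^'m) * norm x"
proof -
  have "norm (A *v x) \<le> L2_set (\<lambda>i. norm (A $ i) * norm x) UNIV"
    unfolding norm_vec_def[of "A *v x"]
    by (rule L2_set_mono) (auto simp: matrix_vector_mul_component Cauchy_Schwarz_ineq2)
  also have "\<dots> = norm A * norm x"
    by (simp add: norm_vec_def[of A] L2_set_left_distrib)
  finally show ?thesis .
qed

text \<open>The columns of \<open>A ** B\<close> are \<open>A\<close> applied to the columns of
  \<open>B\<close>; transposing turns them into the rows from which the norm is computed.\<close>

lemma norm_matrix_matrix_mult_le: "norm (A ** B) \<le> norm (A :: real^'n^'m) * norm (B :: real^'k^'n)"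
proof -
  have "norm (A ** B) = norm (transpose (A ** B))" by (simp add: norm_transpose)
  also have "\<dots> \<le> L2_set (\<lambda>j. norm A * norm (transpose B $ j)) UNIV"
    unfolding norm_vec_def[of "transpose (A ** B)"]
  proof (rule L2_set_mono)
    fix j
    have "transpose (A ** B) $ j = A *v (transpose B $ j)"
      by (simp add: transpose_def matrix_matrix_mult_def matrix_vector_mult_def vec_eq_iff)
    thus "norm (transpose (A ** B) $ j) \<le> norm A * norm (transpose B $ j)"
      using norm_matrix_vector_mult_le[of A "transpose B $ j"] by simp
  qed auto
  also have "\<dots> = norm A * norm (transpose B)"
    by (simp add: norm_vec_def[of "transpose B"] L2_set_right_distrib)
  finally show ?thesis by (simp add: norm_transpose)
qed

lemma matrix_power_commute: "A ** matrix_power A k = matrix_power A k ** A"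
  by (induction k) (simp_all, metis matrix_mul_assoc)

lemma matrix_power_transpose: "matrix_power (transpose A) k = transpose (matrix_power A k)"
  by (induction k) (auto simp: matrix_transpose_mul matrix_power_commute transpose_mat)

lemma matrix_power_scaleR: "matrix_power (t *\<^sub>R A) k = t ^ k *\<^sub>R matrix_power A k"
  by (induction k)
     (auto simp: matrix_matrix_mult_def vec_eq_iff sum_distrib_left algebra_simps)

text \<open>The factor \<open>norm (mat 1)\<close> appears because this is the Frobenius norm, for
  which the identity matrix generally does not have norm 1.\<close>

lemma norm_matrix_power_le:
  "norm (matrix_power (A :: real^'n^'n) k) \<le> norm (mat 1 :: real^'n^'n) * norm A ^ k"
proof (induction k)
  case (Suc k)
  have "norm (matrix_power A (Suc k)) \<le> norm A * norm (matrix_power A k)"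
    by (simp add: norm_matrix_matrix_mult_le)
  also have "\<dots> \<le> norm A * (norm (mat 1 :: real^'n^'n) * norm A ^ k)"
    using Suc by (intro mult_left_mono) auto
  finally show ?case by (simp add: mult_ac)
qed simp

lemma summable_matrix_exp:
  "summable (\<lambda>k. (1 / fact k) *\<^sub>R matrix_power (A :: real^'n^'n) k)"
proof (rule summable_comparison_test')
  show "summable (\<lambda>k. norm (mat 1 :: real^'n^'n) * (inverse (fact k) * norm A ^ k))"
    by (intro summable_mult summable_exp)
  fix k :: nat
  show "norm ((1 / fact k) *\<^sub>R matrix_power A k) \<le>
      norm (mat 1 :: real^'n^'n) * (inverse (fact k) * norm A ^ k)"
    using mult_left_mono[OF norm_matrix_power_le[of A k], of "inverse (fact k)"]
    by (simp add: field_simps)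
qed

lemma matrix_exp_transpose: "matrix_exp (transpose A) = transpose (matrix_exp A)"
  unfolding matrix_exp_def
  using bounded_linear.suminf[OF bounded_linear_transpose summable_matrix_exp[of A]]
  by (simp add: matrix_power_transpose linear_cmul[OF bounded_linear.linear[OF bounded_linear_transpose]])

lemma matrix_exp_0: "matrix_exp 0 = (mat 1 :: real^'n^'n)"
proof -
  have "matrix_power (0 :: real^'n^'n) k = (if k = 0 then mat 1 else 0)" for k
    by (cases k) (auto simp: bounded_bilinear.zero_left[OF bounded_bilinear_matrix_matrix_mult])
  hence "(\<lambda>k. (1 / fact k) *\<^sub>R matrix_power (0 :: real^'n^'n) k) = (\<lambda>k. if k = 0 then mat 1 else 0)"
    by auto
  thus ?thesis unfolding matrix_exp_def
    by (simp add: sums_unique[OF sums_If_finite_set[of "{0}" "\<lambda>_. mat 1", simplified], symmetric])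
qed

text \<open>Entrywise the exponential is a scalar power series in t, so differentiation in t reduces
  to termwise differentiation of real power series.\<close>

lemma matrix_exp_entry_power_series:
  fixes A :: "real^'n^'n"
  shows "matrix_exp (t *\<^sub>R A) $ i $ j = (\<Sum>k. matrix_power A k $ i $ j / fact k * t ^ k)"
  and summable_matrix_exp_entry: "summable (\<lambda>k. matrix_power A k $ i $ j / fact k * t ^ k)"
proof -
  have bl: "bounded_linear (\<lambda>M :: real^'n^'n. M $ i $ j)"
    by (rule bounded_linear_compose[OF bounded_linear_vec_nth bounded_linear_vec_nth])
  have eq: "((1 / fact k) *\<^sub>R matrix_power (t *\<^sub>R A) k) $ i $ j = matrix_power A k $ i $ j / fact k * t ^ k" for k
    by (simp add: matrix_power_scaleR)
  show "matrix_exp (t *\<^sub>R A) $ i $ j = (\<Sum>k. matrix_power A k $ i $ j / fact k * t ^ k)"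
    unfolding matrix_exp_def
    using bounded_linear.suminf[OF bl summable_matrix_exp[of "t *\<^sub>R A"]]
    by (simp only: eq)
  show "summable (\<lambda>k. matrix_power A k $ i $ j / fact k * t ^ k)"
    using bounded_linear.summable[OF bl summable_matrix_exp[of "t *\<^sub>R A"]]
    by (simp only: eq)
qed

text \<open>Powers of \<open>A\<close> commute with \<open>A\<close>; the factor is put on the right
  because the drift of the operator produces the exponential applied to
  \<open>A *v x\<close>.\<close>

lemma matrix_exp_entry_has_field_derivative:
  "((\<lambda>t. matrix_exp (t *\<^sub>R A) $ i $ j) has_field_derivative (matrix_exp (t *\<^sub>R A) ** A) $ i $ j) (at t)"
proof -
  let ?c = "\<lambda>i j k. matrix_power A k $ i $ j / fact k"
  have "((\<lambda>t. matrix_exp (t *\<^sub>R A) $ i $ j) has_field_derivative (\<Sum>k. diffs (?c i j) k * t ^ k)) (at t)"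
    unfolding matrix_exp_entry_power_series
    by (rule termdiffs_strong_converges_everywhere) (rule summable_matrix_exp_entry)
  also have "diffs (?c i j) k = (\<Sum>l\<in>UNIV. ?c i l k * A $ l $ j)" for k
  proof -
    have "matrix_power A (Suc k) $ i $ j = (\<Sum>l\<in>UNIV. matrix_power A k $ i $ l * A $ l $ j)"
      by (simp only: matrix_power.simps matrix_power_commute) (simp add: matrix_matrix_mult_def)
    thus ?thesis by (simp add: diffs_def sum_divide_distrib)
  qed
  hence "(\<Sum>k. diffs (?c i j) k * t ^ k) = (\<Sum>k. \<Sum>l\<in>UNIV. ?c i l k * t ^ k * A $ l $ j)"
    by (simp add: sum_distrib_right sum_distrib_left mult_ac)
  also have "\<dots> = (\<Sum>l\<in>UNIV. \<Sum>k. ?c i l k * t ^ k * A $ l $ j)"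
    by (rule suminf_sum) (intro summable_mult2 summable_matrix_exp_entry)
  also have "\<dots> = (matrix_exp (t *\<^sub>R A) ** A) $ i $ j"
    unfolding matrix_matrix_mult_def vec_lambda_beta matrix_exp_entry_power_series
    by (intro sum.cong refl suminf_mult2[symmetric] summable_matrix_exp_entry)
  finally show ?thesis .
qed

lemma continuous_matrix_exp: "continuous_on S (\<lambda>t. matrix_exp (t *\<^sub>R A))"
proof -
  have "continuous_on S (\<lambda>t. matrix_exp (t *\<^sub>R A) $ i $ j)" for i j
    by (rule DERIV_continuous_on) (rule DERIV_subset[OF matrix_exp_entry_has_field_derivative], simp)
  hence "continuous_on S (\<lambda>t. \<chi> i j. matrix_exp (t *\<^sub>R A) $ i $ j)"
    by (intro continuous_on_vec_lambda)
  thus ?thesis by (simp add: vec_nth_inverse)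
qed

lemma inner_matrix_exp_has_field_derivative:
  "((\<lambda>t. u \<bullet> (matrix_exp (t *\<^sub>R A) *v x)) has_field_derivative
     u \<bullet> (matrix_exp (t *\<^sub>R A) *v (A *v x))) (at t)"
  unfolding matrix_vector_mul_assoc
  unfolding inner_vec_def inner_real_def matrix_vector_mult_def vec_lambda_beta
  by (auto intro!: derivative_eq_intros matrix_exp_entry_has_field_derivative simp: mult_ac)

section \<open>Second-order jets of bounded functions\<close>

definition outer_product :: "real^'n \<Rightarrow> real^'n \<Rightarrow> real^'n^'n" where
  "outer_product u v = (\<chi> i j. u $ i * v $ j)"

lemma outer_product_mult: "outer_product u v *v h = (v \<bullet> h) *\<^sub>R u"
  by (simp add: outer_product_def matrix_vector_mult_def vec_eq_iff inner_vec_def sum_distrib_left mult_ac)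

lemma norm_outer_product: "norm (outer_product u v) = norm u * norm v"
proof -
  have "outer_product u v $ i = u $ i *\<^sub>R v" for i
    by (simp add: outer_product_def vec_eq_iff)
  thus ?thesis
    by (simp add: norm_vec_def[of "outer_product u v"] norm_vec_def[of u] L2_set_left_distrib)
qed

lemma continuous_on_outer_product [continuous_intros]:
  "continuous_on S f \<Longrightarrow> continuous_on S g \<Longrightarrow> continuous_on S (\<lambda>x. outer_product (f x) (g x))"
  unfolding outer_product_def by (intro continuous_intros)

lemma tendsto_outer_product [tendsto_intros]:
  assumes "(f \<longlongrightarrow> u) F" "(g \<longlongrightarrow> v) F"
  shows "((\<lambda>x. outer_product (f x) (g x)) \<longlongrightarrow> outer_product u v) F"
  unfolding outer_product_def by (intro tendsto_intros assms)

text \<open>A quantitative form of \<open>Cb2\<close>: gradient and Hessian are explicit data and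
  one constant bounds all three, so that uniform bounds along a sequence can be expressed.
  Continuity is demanded of \<open>H\<close> only, since \<open>f\<close> and \<open>g\<close>
  inherit it from differentiability.\<close>

definition C2_jet :: "real \<Rightarrow> (real^'n \<Rightarrow> real) \<Rightarrow> (real^'n \<Rightarrow> real^'n) \<Rightarrow> (real^'n \<Rightarrow> real^'n^'n) \<Rightarrow> bool" where
  "C2_jet C f g H \<longleftrightarrow>
     (\<forall>x. (f has_derivative (\<lambda>h. g x \<bullet> h)) (at x)) \<and>
     (\<forall>x. (g has_derivative (\<lambda>h. H x *v h)) (at x)) \<and>
     continuous_on UNIV H \<and>
     (\<forall>x. \<bar>f x\<bar> \<le> C) \<and> (\<forall>x. norm (g x) \<le> C) \<and> (\<forall>x. norm (H x) \<le> C)"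

lemma C2_jetI:
  assumes "\<And>x. (f has_derivative (\<lambda>h. g x \<bullet> h)) (at x)"
    "\<And>x. (g has_derivative (\<lambda>h. H x *v h)) (at x)"
    "continuous_on UNIV H"
    "\<And>x. \<bar>f x\<bar> \<le> C" "\<And>x. norm (g x) \<le> C" "\<And>x. norm (H x) \<le> C"
  shows "C2_jet C f g H"
  using assms by (simp add: C2_jet_def)

lemma C2_jetD:
  assumes "C2_jet C f g H"
  shows "(f has_derivative (\<lambda>h. g x \<bullet> h)) (at x)" "(g has_derivative (\<lambda>h. H x *v h)) (at x)"
    "continuous_on UNIV f" "continuous_on UNIV g" "continuous_on UNIV H"
    "\<bar>f x\<bar> \<le> C" "norm (g x) \<le> C" "norm (H x) \<le> C" "0 \<le> C"
proof -
  show 1: "(f has_derivative (\<lambda>h. g x \<bullet> h)) (at x)" "(g has_derivative (\<lambda>h. H x *v h)) (at x)"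
    "continuous_on UNIV H" "\<bar>f x\<bar> \<le> C" "norm (g x) \<le> C" "norm (H x) \<le> C"
    using assms by (auto simp: C2_jet_def)
  show "0 \<le> C" using 1(4) by linarith
  show "continuous_on UNIV f" "continuous_on UNIV g"
    using assms unfolding C2_jet_def
    by (auto intro!: continuous_at_imp_continuous_on has_derivative_continuous)
qed

lemma C2_jet_mono: "C2_jet C f g H \<Longrightarrow> C \<le> C' \<Longrightarrow> C2_jet C' f g H"
  unfolding C2_jet_def by (meson order_trans)

lemma gradient_C2_jet:
  assumes "C2_jet C f g H" shows "gradient f = g"
proof
  fix x
  have "frechet_derivative f (at x) = (\<lambda>h. g x \<bullet> h)"
    using frechet_derivative_at[OF C2_jetD(1)[OF assms]] by simp
  thus "gradient f x = g x" by (simp add: gradient_def vec_eq_iff inner_axis)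
qed

lemma hessian_C2_jet:
  assumes "C2_jet C f g H" shows "hessian f = H"
proof
  fix x
  have "frechet_derivative g (at x) = (\<lambda>h. H x *v h)"
    using frechet_derivative_at[OF C2_jetD(2)[OF assms]] by simp
  thus "hessian f x = H x"
    by (simp add: hessian_def gradient_C2_jet[OF assms] jacobian_def matrix_of_matrix_vector_mul)
qed

lemma C2_jet_Cb2:
  assumes "f \<in> Cb2"
  obtains C where "C2_jet C f (gradient f) (hessian f)"
proof -
  have *: "continuous_on UNIV f" "bounded (range f)" "\<And>x. f differentiable (at x)"
     "continuous_on UNIV (gradient f)" "bounded (range (gradient f))"
     "\<And>x. gradient f differentiable (at x)"
     "continuous_on UNIV (hessian f)" "bounded (range (hessian f))"
    using assms by (auto simp: Cb2_def)
  obtain C1 C2 C3 where C: "\<And>x. norm (f x) \<le> C1" "\<And>x. norm (gradient f x) \<le> C2" "\<And>x. norm (hessian f x) \<le> C3"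
    using *(2,5,8) unfolding bounded_iff by auto
  have "C2_jet (max C1 (max C2 C3)) f (gradient f) (hessian f)"
  proof (rule C2_jetI)
    fix x
    have d: "(f has_derivative frechet_derivative f (at x)) (at x)"
      using *(3) by (simp add: frechet_derivative_works[symmetric])
    then interpret bounded_linear "frechet_derivative f (at x)" by (rule has_derivative_bounded_linear)
    \<comment> \<open>\<open>gradient\<close> records the derivative on the axis vectors only;
      linearity recovers it on every \<open>h\<close>.\<close>
    have "frechet_derivative f (at x) h = gradient f x \<bullet> h" for h
    proof -
      have "frechet_derivative f (at x) h = frechet_derivative f (at x) (\<Sum>i\<in>UNIV. h $ i *\<^sub>R axis i 1)"
        by (subst basis_expansion[of h, unfolded scalar_mult_eq_scaleR, symmetric]) simp
      thus ?thesis by (simp add: sum scaleR gradient_def inner_vec_def mult_ac)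
    qed
    thus "(f has_derivative (\<lambda>h. gradient f x \<bullet> h)) (at x)" using d by (metis (no_types, lifting) ext)
    show "(gradient f has_derivative (*v) (hessian f x)) (at x)"
      using *(6) by (simp add: hessian_def jacobian_works[symmetric])
    show "\<bar>f x\<bar> \<le> max C1 (max C2 C3)" using C(1)[of x] by simp
    show "norm (gradient f x) \<le> max C1 (max C2 C3)" using C(2)[of x] by simp
    show "norm (hessian f x) \<le> max C1 (max C2 C3)" using C(3)[of x] by simp
  qed (rule *(7))
  thus ?thesis by (rule that)
qed

lemma C2_jet_add:
  assumes "C2_jet C f g H" "C2_jet C' f' g' H'"
  shows "C2_jet (C + C') (\<lambda>x. f x + f' x) (\<lambda>x. g x + g' x) (\<lambda>x. H x + H' x)"
proof (rule C2_jetI)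
  fix x
  note d = C2_jetD[OF assms(1)] C2_jetD[OF assms(2)]
  show "((\<lambda>x. f x + f' x) has_derivative (\<lambda>h. (g x + g' x) \<bullet> h)) (at x)"
    by (auto intro!: derivative_eq_intros d simp: algebra_simps)
  show "((\<lambda>x. g x + g' x) has_derivative (\<lambda>h. (H x + H' x) *v h)) (at x)"
    by (auto intro!: derivative_eq_intros d simp: matrix_vector_mult_add_rdistrib)
  show "\<bar>f x + f' x\<bar> \<le> C + C'" using C2_jetD(6)[OF assms(1), of x] C2_jetD(6)[OF assms(2), of x] by linarith
  show "norm (g x + g' x) \<le> C + C'" "norm (H x + H' x) \<le> C + C'"
    by (intro norm_triangle_mono d)+
qed (intro continuous_intros C2_jetD[OF assms(1)] C2_jetD[OF assms(2)])

lemma C2_jet_scale: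
  assumes "C2_jet C f g H"
  shows "C2_jet (\<bar>c\<bar> * C) (\<lambda>x. c * f x) (\<lambda>x. c *\<^sub>R g x) (\<lambda>x. c *\<^sub>R H x)"
proof (rule C2_jetI)
  fix x
  note d = C2_jetD[OF assms]
  show "((\<lambda>x. c * f x) has_derivative (\<lambda>h. (c *\<^sub>R g x) \<bullet> h)) (at x)"
    by (auto intro!: derivative_eq_intros d)
  show "((\<lambda>x. c *\<^sub>R g x) has_derivative (\<lambda>h. (c *\<^sub>R H x) *v h)) (at x)"
    by (auto intro!: derivative_eq_intros d simp: scaleR_matrix_vector_assoc[symmetric])
  show "\<bar>c * f x\<bar> \<le> \<bar>c\<bar> * C" "norm (c *\<^sub>R g x) \<le> \<bar>c\<bar> * C" "norm (c *\<^sub>R H x) \<le> \<bar>c\<bar> * C"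
    by (auto simp: abs_mult intro!: mult_left_mono d)
qed (intro continuous_intros C2_jetD[OF assms(1)])

text \<open>The 4 counts the terms in the Hessian of a product, each bounded by
  \<open>C * C'\<close>.\<close>

lemma C2_jet_mult:
  assumes "C2_jet C f g H" "C2_jet C' f' g' H'"
  shows "C2_jet (4 * C * C') (\<lambda>x. f x * f' x) (\<lambda>x. f x *\<^sub>R g' x + f' x *\<^sub>R g x)
    (\<lambda>x. f x *\<^sub>R H' x + f' x *\<^sub>R H x + outer_product (g x) (g' x) + outer_product (g' x) (g x))"
proof (rule C2_jetI)
  fix x
  note d = C2_jetD[OF assms(1)] C2_jetD[OF assms(2)]
  show "((\<lambda>x. f x * f' x) has_derivative (\<lambda>h. (f x *\<^sub>R g' x + f' x *\<^sub>R g x) \<bullet> h)) (at x)"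
    by (auto intro!: derivative_eq_intros d simp: algebra_simps inner_add_left)
  show "((\<lambda>x. f x *\<^sub>R g' x + f' x *\<^sub>R g x) has_derivative
     (\<lambda>h. (f x *\<^sub>R H' x + f' x *\<^sub>R H x + outer_product (g x) (g' x) + outer_product (g' x) (g x)) *v h)) (at x)"
    by (auto intro!: derivative_eq_intros d
        simp: matrix_vector_mult_add_rdistrib outer_product_mult scaleR_matrix_vector_assoc[symmetric])
  have 1: "\<bar>f x * f' x\<bar> \<le> C * C'" "norm (f x *\<^sub>R g' x) \<le> C * C'" "norm (f' x *\<^sub>R g x) \<le> C * C'"
    "norm (f x *\<^sub>R H' x) \<le> C * C'" "norm (f' x *\<^sub>R H x) \<le> C * C'"
    "norm (outer_product (g x) (g' x)) \<le> C * C'" "norm (outer_product (g' x) (g x)) \<le> C * C'" "0 \<le> C * C'"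
    unfolding norm_scaleR norm_outer_product abs_mult mult.commute[of "\<bar>f' x\<bar>"] mult.commute[of "norm (g' x)"]
    by (intro mult_mono mult_nonneg_nonneg d norm_ge_zero abs_ge_zero)+
  show "\<bar>f x * f' x\<bar> \<le> 4 * C * C'" using 1 by simp
  show "norm (f x *\<^sub>R g' x + f' x *\<^sub>R g x) \<le> 4 * C * C'"
    using 1 norm_triangle_ineq[of "f x *\<^sub>R g' x" "f' x *\<^sub>R g x"] by simp
  show "norm (f x *\<^sub>R H' x + f' x *\<^sub>R H x + outer_product (g x) (g' x) + outer_product (g' x) (g x)) \<le> 4 * C * C'"
    using norm_triangle_mono[OF norm_triangle_mono[OF norm_triangle_mono[OF 1(4) 1(5)] 1(6)] 1(7)] by simp
qed (intro continuous_intros C2_jetD[OF assms(1)] C2_jetD[OF assms(2)])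

text \<open>By the chain rule, orders 0, 1 and 2 pick up the factors 1, \<open>norm E\<close> and
  \<open>norm E * norm E\<close>; \<open>(1 + norm E)\<^sup>2\<close> dominates all three.\<close>

lemma C2_jet_affine:
  assumes "C2_jet C f g H"
  shows "C2_jet (C * (1 + norm E)\<^sup>2) (\<lambda>x. f (E *v x + y)) (\<lambda>x. transpose E *v g (E *v x + y))
    (\<lambda>x. transpose E ** H (E *v x + y) ** E)"
proof (rule C2_jetI)
  fix x
  note d = C2_jetD[OF assms]
  have dE: "((\<lambda>x. E *v x + y) has_derivative (\<lambda>h. E *v h)) (at x)"
    by (auto intro!: derivative_eq_intros bounded_linear_imp_has_derivative matrix_vector_mul_bounded_linear)
  show "((\<lambda>x. f (E *v x + y)) has_derivative (\<lambda>h. (transpose E *v g (E *v x + y)) \<bullet> h)) (at x)"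
    using has_derivative_compose[OF dE d(1)] by (simp add: dot_lmul_matrix vector_transpose_matrix)
  have "((\<lambda>x. transpose E *v g (E *v x + y)) has_derivative
      (\<lambda>h. transpose E *v (H (E *v x + y) *v (E *v h)))) (at x)"
    by (rule bounded_linear.has_derivative[OF matrix_vector_mul_bounded_linear])
       (rule has_derivative_compose[OF dE d(2)])
  thus "((\<lambda>x. transpose E *v g (E *v x + y)) has_derivative
      (\<lambda>h. (transpose E ** H (E *v x + y) ** E) *v h)) (at x)"
    by (simp add: matrix_vector_mul_assoc matrix_mul_assoc)
  have C: "0 \<le> C" by (rule d)
  have b: "1 \<le> (1 + norm E)\<^sup>2" "norm E \<le> (1 + norm E)\<^sup>2" "norm E * norm E \<le> (1 + norm E)\<^sup>2"
    by (auto simp: power2_eq_square algebra_simps)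
  show "\<bar>f (E *v x + y)\<bar> \<le> C * (1 + norm E)\<^sup>2"
    using d(6)[of "E *v x + y"] mult_left_mono[OF b(1) C] by simp
  have "norm (transpose E *v g (E *v x + y)) \<le> norm E * C"
    by (rule order_trans[OF norm_matrix_vector_mult_le]) (auto simp: norm_transpose intro!: mult_left_mono d)
  also have "\<dots> \<le> C * (1 + norm E)\<^sup>2" using mult_left_mono[OF b(2) C] by (simp add: mult_ac)
  finally show "norm (transpose E *v g (E *v x + y)) \<le> C * (1 + norm E)\<^sup>2" .
  have "norm (transpose E ** H (E *v x + y) ** E) \<le> (norm E * C) * norm E"
    by (intro order_trans[OF norm_matrix_matrix_mult_le] mult_right_mono norm_ge_zero)
       (auto simp: norm_transpose intro!: mult_left_mono d)
  also have "\<dots> \<le> C * (1 + norm E)\<^sup>2" using mult_left_mono[OF b(3) C] by (simp add: mult_ac)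
  finally show "norm (transpose E ** H (E *v x + y) ** E) \<le> C * (1 + norm E)\<^sup>2" .
next
  have "continuous_on UNIV (\<lambda>x. H (E *v x + y))"
    by (rule continuous_on_compose2[OF C2_jetD(5)[OF assms]])
       (auto intro!: continuous_on_add linear_continuous_on[OF matrix_vector_mul_bounded_linear])
  thus "continuous_on UNIV (\<lambda>x. transpose E ** H (E *v x + y) ** E)"
    by (intro bounded_bilinear.continuous_on[OF bounded_bilinear_matrix_matrix_mult] continuous_on_const)
qed

lemma C2_jet_lipschitz_gradient:
  assumes "C2_jet C f g H"
  shows "norm (g x - g y) \<le> C * norm (x - y)"
proof (rule differentiable_bound[of UNIV g "\<lambda>x h. H x *v h"])
  fix z :: "real^'a"
  show "(g has_derivative (*v) (H z)) (at z within UNIV)"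
    using C2_jetD(2)[OF assms] by simp
  show "onorm ((*v) (H z)) \<le> C"
    by (rule onorm_le) (rule order_trans[OF norm_matrix_vector_mult_le mult_right_mono[OF C2_jetD(8)[OF assms]]], simp)
qed auto

lemma C2_jet_taylor:
  assumes "C2_jet C f g H"
  shows "\<bar>f (x + y) - f x - y \<bullet> g x\<bar> \<le> C * (norm y)\<^sup>2"
proof -
  \<comment> \<open>Mean value inequality for \<open>f\<close> minus its linearization at
    \<open>x\<close>, on the ball of radius \<open>norm y\<close>, where the gradient of the
    difference is at most \<open>C * norm y\<close>. This gives the constant \<open>C\<close>
    instead of the sharper \<open>C / 2\<close>.\<close>
  have "norm ((f (x + y) - g x \<bullet> (x + y)) - (f x - g x \<bullet> x)) \<le> (C * norm y) * norm ((x + y) - x)"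
  proof (rule differentiable_bound[of "cball x (norm y)" _ "\<lambda>z h. (g z - g x) \<bullet> h"])
    fix z assume z: "z \<in> cball x (norm y)"
    show "((\<lambda>z. f z - g x \<bullet> z) has_derivative (\<lambda>h. (g z - g x) \<bullet> h)) (at z within cball x (norm y))"
      by (auto intro!: derivative_eq_intros has_derivative_at_withinI[OF C2_jetD(1)[OF assms]] simp: inner_diff_left)
    have "norm (g z - g x) \<le> C * norm (z - x)" by (rule C2_jet_lipschitz_gradient[OF assms])
    also have "\<dots> \<le> C * norm y"
      using z by (intro mult_left_mono C2_jetD(9)[OF assms]) (simp add: dist_norm norm_minus_commute)
    finally have "norm (g z - g x) \<le> C * norm y" .
    thus "onorm (\<lambda>h. (g z - g x) \<bullet> h) \<le> C * norm y"
      by (intro onorm_le order_trans[OF Cauchy_Schwarz_ineq2[of "g z - g x"], folded real_norm_def] mult_right_mono) auto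
  qed (auto simp: dist_norm)
  thus ?thesis by (simp add: power2_eq_square inner_add_right inner_commute algebra_simps)
qed

section \<open>Differentiation under an integral sign\<close>

lemma has_derivative_integral_dominated:
  fixes k :: "'w \<Rightarrow> 'a::euclidean_space \<Rightarrow> 'b::{banach, second_countable_topology}"
  assumes der: "\<And>w y. (k w has_derivative D w y) (at y)"
    and k: "\<And>y. integrable M (\<lambda>w. k w y)"
    and D: "\<And>h. (\<lambda>w. D w x h) \<in> borel_measurable M"
    and b: "\<And>w y h. norm (D w y h) \<le> b w * norm h" "integrable M b"
  shows "((\<lambda>y. \<integral>w. k w y \<partial>M) has_derivative (\<lambda>h. \<integral>w. D w x h \<partial>M)) (at x)"
proof -
  have lin: "bounded_linear (D w y)" for w y using der by (rule has_derivative_bounded_linear)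
  have Di: "integrable M (\<lambda>w. D w x h)" for h
    by (rule Bochner_Integration.integrable_bound[OF integrable_mult_left[OF b(2), of "norm h"] D])
       (use b(1) in \<open>auto intro!: AE_I2 order_trans[OF _ abs_ge_self]\<close>)
  have bl: "bounded_linear (\<lambda>h. \<integral>w. D w x h \<partial>M)"
  proof (rule bounded_linear_intro[where K = "\<integral>w. b w \<partial>M"])
    fix h h' :: 'a and r :: real
    show "(\<integral>w. D w x (h + h') \<partial>M) = (\<integral>w. D w x h \<partial>M) + (\<integral>w. D w x h' \<partial>M)"
      by (simp add: linear_add[OF bounded_linear.linear[OF lin]] Di)
    show "(\<integral>w. D w x (r *\<^sub>R h) \<partial>M) = r *\<^sub>R (\<integral>w. D w x h \<partial>M)"
      by (simp add: linear_cmul[OF bounded_linear.linear[OF lin]])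
    have "norm (\<integral>w. D w x h \<partial>M) \<le> (\<integral>w. norm (D w x h) \<partial>M)" by simp
    also have "\<dots> \<le> (\<integral>w. b w * norm h \<partial>M)"
      by (intro integral_mono) (use b Di in auto)
    also have "\<dots> = norm h * (\<integral>w. b w \<partial>M)" by simp
    finally show "norm (\<integral>w. D w x h \<partial>M) \<le> norm h * (\<integral>w. b w \<partial>M)" .
  qed
  have lip: "norm (k w y - k w z) \<le> b w * norm (y - z)" for w y z
    by (rule differentiable_bound[of UNIV "k w" "\<lambda>y. D w y"]) (use der b(1) in \<open>auto intro!: onorm_le\<close>)
  have "((\<lambda>y. ((\<integral>w. k w y \<partial>M) - (\<integral>w. k w x \<partial>M) - (\<integral>w. D w x (y - x) \<partial>M)) /\<^sub>R norm (y - x)) \<longlongrightarrow> 0) (at x)"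
    unfolding tendsto_at_iff_sequentially o_def
  proof (intro allI impI)
    fix X assume X: "\<forall>i. X i \<in> UNIV - {x}" "X \<longlonglongrightarrow> x"
    define e where "e i w = (k w (X i) - k w x - D w x (X i - x)) /\<^sub>R norm (X i - x)" for i w
    have "(\<lambda>i. \<integral>w. e i w \<partial>M) \<longlonglongrightarrow> (\<integral>w. 0 \<partial>M)"
    proof (rule integral_dominated_convergence)
      show "integrable M (\<lambda>w. 2 * b w)" using b by simp
      show "AE w in M. (\<lambda>i. e i w) \<longlonglongrightarrow> 0"
      proof (rule AE_I2)
        fix w
        have "((\<lambda>y. (k w y - k w x - D w x (y - x)) /\<^sub>R norm (y - x)) \<longlongrightarrow> 0) (at x)"
          using der[of w x] unfolding has_derivative_at_within by auto
        thus "(\<lambda>i. e i w) \<longlonglongrightarrow> 0"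
          unfolding tendsto_at_iff_sequentially o_def e_def using X by blast
      qed
      fix i
      show "e i \<in> borel_measurable M"
        unfolding e_def using k D by (auto dest: borel_measurable_integrable)
      show "AE w in M. norm (e i w) \<le> 2 * b w"
      proof (rule AE_I2)
        fix w
        \<comment> \<open>One \<open>b w\<close> comes from the mean value inequality, the other
          from the derivative itself; together they give the dominating function
          \<open>2 * b w\<close>.\<close>
        have "norm (k w (X i) - k w x - D w x (X i - x)) \<le> b w * norm (X i - x) + b w * norm (X i - x)"
          by (intro order_trans[OF norm_triangle_ineq4] add_mono lip b(1))
        thus "norm (e i w) \<le> 2 * b w"
          using X(1) by (auto simp: e_def divide_simps)
      qed
    qed auto
    moreover have "(\<integral>w. e i w \<partial>M) = ((\<integral>w. k w (X i) \<partial>M) - (\<integral>w. k w x \<partial>M) - (\<integral>w. D w x (X i - x) \<partial>M)) /\<^sub>R norm (X i - x)" for i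
      unfolding e_def by (simp add: k Di Bochner_Integration.integral_diff)
    ultimately show "(\<lambda>i. ((\<integral>w. k w (X i) \<partial>M) - (\<integral>w. k w x \<partial>M) - (\<integral>w. D w x (X i - x) \<partial>M)) /\<^sub>R norm (X i - x)) \<longlonglongrightarrow> 0"
      by simp
  qed
  thus ?thesis using bl unfolding has_derivative_at_within by simp
qed

text \<open>The common tool behind the semigroup, convolutions and mollification: each is a
  superposition of jets whose constants are integrable in the parameter.\<close>

lemma C2_jet_integral:
  fixes f :: "'w \<Rightarrow> real^'n \<Rightarrow> real"
  assumes jet: "\<And>w. C2_jet (b w) (f w) (g w) (H w)" and b: "integrable M b"
    and meas: "\<And>x. (\<lambda>w. f w x) \<in> borel_measurable M" "\<And>x. (\<lambda>w. g w x) \<in> borel_measurable M"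
      "\<And>x. (\<lambda>w. H w x) \<in> borel_measurable M"
  shows "C2_jet (\<integral>w. b w \<partial>M) (\<lambda>x. \<integral>w. f w x \<partial>M) (\<lambda>x. \<integral>w. g w x \<partial>M) (\<lambda>x. \<integral>w. H w x \<partial>M)"
proof -
  note d = C2_jetD[OF jet]
  have int: "integrable M (\<lambda>w. f w x)" "integrable M (\<lambda>w. g w x)" "integrable M (\<lambda>w. H w x)" for x
    by (rule Bochner_Integration.integrable_bound[OF b]; use meas d(6-8) in \<open>force intro!: AE_I2 order_trans[OF _ abs_ge_self]\<close>)+
  show ?thesis
  proof (rule C2_jetI)
    fix x
    have "((\<lambda>x. \<integral>w. f w x \<partial>M) has_derivative (\<lambda>h. \<integral>w. g w x \<bullet> h \<partial>M)) (at x)"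
      by (rule has_derivative_integral_dominated[OF d(1) int(1) _ _ b])
         (use meas(2) in \<open>auto intro!: order_trans[OF Cauchy_Schwarz_ineq2[of "g _ _"]] mult_right_mono d\<close>)
    thus "((\<lambda>x. \<integral>w. f w x \<partial>M) has_derivative (\<lambda>h. (\<integral>w. g w x \<partial>M) \<bullet> h)) (at x)"
      by (simp add: int)
    have bl: "bounded_linear (\<lambda>A :: real^'n^'n. A *v h)" for h
      by (rule bounded_bilinear.bounded_linear_left[OF bounded_bilinear_matrix_vector_mult])
    have "((\<lambda>x. \<integral>w. g w x \<partial>M) has_derivative (\<lambda>h. \<integral>w. H w x *v h \<partial>M)) (at x)"
      by (rule has_derivative_integral_dominated[OF d(2) int(2) _ _ b])
         (auto intro!: order_trans[OF norm_matrix_vector_mult_le] mult_right_mono d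
           borel_measurable_continuous_onI[THEN measurable_compose_rev, OF linear_continuous_on[OF bl]] meas)
    thus "((\<lambda>x. \<integral>w. g w x \<partial>M) has_derivative (\<lambda>h. (\<integral>w. H w x \<partial>M) *v h)) (at x)"
      by (simp add: integral_bounded_linear[OF bl int(3)])
    show "\<bar>\<integral>w. f w x \<partial>M\<bar> \<le> (\<integral>w. b w \<partial>M)"
      using integral_mono[OF integrable_norm[OF int(1)] b d(6)[folded real_norm_def]]
        order_trans[OF integral_norm_bound] by (metis real_norm_def)
    show "norm (\<integral>w. g w x \<partial>M) \<le> (\<integral>w. b w \<partial>M)" "norm (\<integral>w. H w x \<partial>M) \<le> (\<integral>w. b w \<partial>M)"
      by (rule order_trans[OF integral_norm_bound integral_mono[OF integrable_norm b]], rule int, rule d)+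
  next
    show "continuous_on UNIV (\<lambda>x. \<integral>w. H w x \<partial>M)"
      unfolding continuous_on_sequentially o_def
    proof (intro ballI allI impI)
      fix X x assume X: "(\<forall>n. X n \<in> UNIV) \<and> X \<longlonglongrightarrow> (x :: real^'n)"
      show "(\<lambda>i. \<integral>w. H w (X i) \<partial>M) \<longlonglongrightarrow> (\<integral>w. H w x \<partial>M)"
      proof (rule integral_dominated_convergence[OF meas(3) meas(3) b])
        show "AE w in M. (\<lambda>i. H w (X i)) \<longlonglongrightarrow> H w x"
          using d(5) X by (auto intro!: AE_I2 simp: continuous_on_sequentially o_def)
        show "AE w in M. norm (H w (X i)) \<le> b w" for i using d(8) by auto
      qed
    qed
  qed
qed

section \<open>The Ornstein--Uhlenbeck operator and semigroup on jets\<close>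

lemma iexp_eq_cis: "iexp x = cis x" by (simp add: cis_conv_exp)

lemma cmod_iexp_diff_le: "cmod (iexp x - 1 - \<i> * complex_of_real x) \<le> x\<^sup>2"
proof -
  have "cmod (iexp x - (\<Sum>k\<le>1. (\<i> * x)^k / fact k)) \<le> \<bar>x\<bar>^(Suc 1) / fact (Suc 1)"
    by (rule iexp_approx1)
  also have "\<dots> \<le> x\<^sup>2" by (simp add: power2_eq_square[symmetric])
  finally show ?thesis by (simp add: algebra_simps)
qed

lemma C2_jet_trig:
  "C2_jet (cmod w * (1 + norm u)\<^sup>2) (\<lambda>x. Re (w * iexp (u \<bullet> x))) (\<lambda>x. Re (\<i> * (w * iexp (u \<bullet> x))) *\<^sub>R u)
     (\<lambda>x. - Re (w * iexp (u \<bullet> x)) *\<^sub>R outer_product u u)"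
proof (rule C2_jetI)
  fix x
  show "((\<lambda>x. Re (w * iexp (u \<bullet> x))) has_derivative (\<lambda>h. (Re (\<i> * (w * iexp (u \<bullet> x))) *\<^sub>R u) \<bullet> h)) (at x)"
    unfolding iexp_eq_cis by (auto intro!: derivative_eq_intros simp: algebra_simps)
  show "((\<lambda>x. Re (\<i> * (w * iexp (u \<bullet> x))) *\<^sub>R u) has_derivative (\<lambda>h. (- Re (w * iexp (u \<bullet> x)) *\<^sub>R outer_product u u) *v h)) (at x)"
    unfolding iexp_eq_cis
    by (auto intro!: derivative_eq_intros simp: algebra_simps outer_product_mult scaleR_matrix_vector_assoc[symmetric])
  have n: "\<bar>Re (w * iexp (u \<bullet> x))\<bar> \<le> cmod w" "\<bar>Re (\<i> * (w * iexp (u \<bullet> x)))\<bar> \<le> cmod w"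
    by (rule order_trans[OF abs_Re_le_cmod], simp add: norm_mult)+
  have b: "1 \<le> (1 + norm u)\<^sup>2" "norm u \<le> (1 + norm u)\<^sup>2" "norm u * norm u \<le> (1 + norm u)\<^sup>2"
    by (auto simp: power2_eq_square algebra_simps)
  show "\<bar>Re (w * iexp (u \<bullet> x))\<bar> \<le> cmod w * (1 + norm u)\<^sup>2"
    using mult_mono[OF n(1) b(1)] by simp
  show "norm (Re (\<i> * (w * iexp (u \<bullet> x))) *\<^sub>R u) \<le> cmod w * (1 + norm u)\<^sup>2"
    unfolding norm_scaleR using mult_mono[OF n(2) b(2)] by simp
  show "norm (- Re (w * iexp (u \<bullet> x)) *\<^sub>R outer_product u u) \<le> cmod w * (1 + norm u)\<^sup>2"
    unfolding norm_scaleR norm_outer_product abs_minus_cancel using mult_mono[OF n(1) b(3)] by simp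
qed (intro continuous_intros)

lemma trace_outer_product: "trace (Q ** outer_product u v) = (Q *v u) \<bullet> v"
  by (simp add: trace_def matrix_matrix_mult_def matrix_vector_mult_def outer_product_def inner_vec_def
      sum_distrib_left sum_distrib_right mult_ac)

lemma bounded_linear_trace_mult: "bounded_linear (\<lambda>H :: real^'n^'n. trace (Q ** H))"
  unfolding linear_conv_bounded_linear[symmetric] trace_def matrix_matrix_mult_def
  by (rule linearI) (auto simp: sum.distrib sum_distrib_left algebra_simps)

text \<open>The laws enter through their characteristic functions at each fixed time; every
  statement on how \<open>\<mu> t\<close> depends on t has to be extracted from these.\<close>

locale OU_data =
  fixes A Q :: "real^'n^'n" and a :: "real^'n" and \<nu> :: "(real^'n) measure"
    and \<mu> :: "real \<Rightarrow> (real^'n) measure"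
  assumes levy: "levy_measure \<nu>"
    and law: "\<And>t. 0 \<le> t \<Longrightarrow> OU_law A Q a \<nu> t (\<mu> t)"
begin

abbreviation E :: "real \<Rightarrow> real^'n^'n" where "E t \<equiv> matrix_exp (t *\<^sub>R A)"
abbreviation P :: "real \<Rightarrow> (real^'n \<Rightarrow> real) \<Rightarrow> real^'n \<Rightarrow> real" where "P \<equiv> OU_semigroup A \<mu>"
abbreviation L :: "(real^'n \<Rightarrow> real) \<Rightarrow> real^'n \<Rightarrow> real" where "L \<equiv> OU_operator A Q a \<nu>"
abbreviation \<psi> :: "real^'n \<Rightarrow> complex" where "\<psi> \<equiv> levy_exponent Q a \<nu>"
abbreviation csmall :: "real^'n \<Rightarrow> complex" where "csmall \<equiv> indicator {y. norm y \<le> 1}"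
abbreviation small :: "real^'n \<Rightarrow> real" where "small \<equiv> indicator {y. norm y \<le> 1}"

lemma sets_levy [measurable_cong]: "sets \<nu> = sets borel"
  using levy by (simp add: levy_measure_def)

lemma integrable_levy: "integrable \<nu> (\<lambda>y. min 1 ((norm y)\<^sup>2))"
  by (rule integrableI_nonneg) (use levy in \<open>auto simp: levy_measure_def\<close>)

lemma law_facts:
  assumes "0 \<le> t"
  shows "prob_space (\<mu> t)" "sets (\<mu> t) = sets borel" "space (\<mu> t) = UNIV"
    "(CLINT y|\<mu> t. iexp (h \<bullet> y)) = exp (- integral {0..t} (\<lambda>s. \<psi> (transpose (E s) *v h)))"
proof -
  show "prob_space (\<mu> t)" "sets (\<mu> t) = sets borel"
    using law[OF assms] by (auto simp: OU_law_def)
  thus "space (\<mu> t) = UNIV" using sets_eq_imp_space_eq[of "\<mu> t" borel] by simp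
  have "matrix_exp (s *\<^sub>R transpose A) = transpose (E s)" for s
    using matrix_exp_transpose[of "s *\<^sub>R A"] by (simp add: transpose_scalar)
  thus "(CLINT y|\<mu> t. iexp (h \<bullet> y)) = exp (- integral {0..t} (\<lambda>s. \<psi> (transpose (E s) *v h)))"
    using law[OF assms] by (auto simp: OU_law_def)
qed

lemma law_measurable: "0 \<le> t \<Longrightarrow> g \<in> borel_measurable borel \<Longrightarrow> g \<in> borel_measurable (\<mu> t)"
  using measurable_cong_sets[OF law_facts(2) refl] by blast

lemma law_measurable_continuous:
  assumes "0 \<le> t" "continuous_on UNIV g"
  shows "(\<lambda>y. g (z + y)) \<in> borel_measurable (\<mu> t)"
  by (intro law_measurable assms borel_measurable_continuous_onI
      continuous_on_compose2[OF assms(2)] continuous_intros) auto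

text \<open>The integrand of the nonlocal part, with a free vector field \<open>g\<close> in the
  place of the gradient so that the data of a jet can be inserted.\<close>

definition jump :: "(real^'n \<Rightarrow> real) \<Rightarrow> (real^'n \<Rightarrow> real^'n) \<Rightarrow> real^'n \<Rightarrow> real^'n \<Rightarrow> real" where
  "jump f g x y = f (x + y) - f x - small y * (y \<bullet> g x)"

text \<open>Jumps of norm at most 1 are controlled by the second-order Taylor estimate, larger ones
  by boundedness of \<open>f\<close>; the factor 2 serves the latter.\<close>

lemma jump_bound:
  assumes "C2_jet C f g H"
  shows "\<bar>jump f g x y\<bar> \<le> 2 * C * min 1 ((norm y)\<^sup>2)"
proof (cases "norm y \<le> 1")
  case True
  hence "(norm y)\<^sup>2 \<le> 1" by (simp add: power_le_one)
  moreover have "0 \<le> C * (norm y)\<^sup>2" using C2_jetD(9)[OF assms] by simp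
  ultimately show ?thesis using C2_jet_taylor[OF assms, of x y] True by (simp add: jump_def)
next
  case False
  hence "1 \<le> (norm y)\<^sup>2" by (simp add: one_le_power)
  thus ?thesis
    using False abs_triangle_ineq4[of "f (x + y)" "f x"] C2_jetD(6)[OF assms, of x] C2_jetD(6)[OF assms, of "x + y"]
    by (simp add: jump_def)
qed

lemma jump_measurable:
  assumes "continuous_on UNIV f"
  shows "jump f g x \<in> borel_measurable \<nu>"
proof -
  have [measurable]: "(\<lambda>y. f (x + y)) \<in> borel_measurable borel"
    by (intro borel_measurable_continuous_onI continuous_on_compose2[OF assms] continuous_intros) auto
  show ?thesis unfolding jump_def by measurable
qed

lemma jump_integrable:
  assumes "C2_jet C f g H" shows "integrable \<nu> (jump f g x)"
  by (rule Bochner_Integration.integrable_bound[OF integrable_mult_right[OF integrable_levy, of "2 * C"]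
        jump_measurable[OF C2_jetD(3)[OF assms]]])
     (use jump_bound[OF assms] in \<open>auto intro!: AE_I2 order_trans[OF _ abs_ge_self]\<close>)

lemma L_C2_jet:
  assumes "C2_jet C f g H"
  shows "L f x = 1/2 * trace (Q ** H x) + a \<bullet> g x + (A *v x) \<bullet> g x + (LINT y|\<nu>. jump f g x y)"
  by (simp add: OU_operator_def gradient_C2_jet[OF assms] hessian_C2_jet[OF assms] jump_def)

text \<open>\<open>K\<close> depends on \<open>x\<close> through \<open>norm (A *v x)\<close> but on
  the function only through its jet constant. This linear bound supplies the domination in the time
  integral.\<close>

lemma L_bound: "\<exists>K\<ge>0. \<forall>C f g H. C2_jet C f g H \<longrightarrow> \<bar>L f x\<bar> \<le> K * C"
proof -
  obtain B where B: "B > 0" "\<And>H :: real^'n^'n. norm (trace (Q ** H)) \<le> norm H * B"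
    using bounded_linear.pos_bounded[OF bounded_linear_trace_mult[of Q]] by blast
  define I where "I = (\<integral>y. min 1 ((norm y)\<^sup>2) \<partial>\<nu>)"
  have I: "0 \<le> I" by (simp add: I_def)
  define K where "K = B + norm a + norm (A *v x) + 2 * I"
  have "\<bar>L f x\<bar> \<le> K * C" if j: "C2_jet C f g H" for C f g H
  proof -
    have 1: "\<bar>1/2 * trace (Q ** H x)\<bar> \<le> B * C"
    proof -
      have "\<bar>trace (Q ** H x)\<bar> \<le> C * B"
        using order_trans[OF B(2)[of "H x"] mult_right_mono[OF C2_jetD(8)[OF j, of x], of B]] B(1) by simp
      thus ?thesis by (simp add: mult_ac)
    qed
    have 2: "\<bar>v \<bullet> g x\<bar> \<le> norm v * C" for v
      by (rule order_trans[OF Cauchy_Schwarz_ineq2 mult_left_mono[OF C2_jetD(7)[OF j]]]) simp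
    have "\<bar>LINT y|\<nu>. jump f g x y\<bar> \<le> (LINT y|\<nu>. norm (jump f g x y))"
      using integral_norm_bound[of \<nu> "jump f g x"] by simp
    also have "\<dots> \<le> (LINT y|\<nu>. 2 * C * min 1 ((norm y)\<^sup>2))"
      by (intro integral_mono integrable_norm jump_integrable[OF j] integrable_mult_right integrable_levy)
         (use jump_bound[OF j] in auto)
    also have "\<dots> = 2 * C * I" by (simp add: I_def)
    finally have 3: "\<bar>LINT y|\<nu>. jump f g x y\<bar> \<le> 2 * C * I" .
    show ?thesis unfolding L_C2_jet[OF j] K_def
      using 1 2[of a] 2[of "A *v x"] 3 by (simp add: algebra_simps)
  qed
  moreover have "K \<ge> 0" using B(1) I by (simp add: K_def)
  ultimately show ?thesis by blast
qed

text \<open>The functions must converge everywhere, because the jump integral is nonlocal, whereas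
  the derivatives enter at \<open>x\<close> alone. The jumps are dominated by a multiple of
  \<open>min 1 ((norm y)\<^sup>2)\<close> thanks to the common constant \<open>C\<close>.\<close>

lemma L_tendsto:
  assumes j: "\<And>i. C2_jet C (f i) (g i) (H i)" "C2_jet C' f0 g0 H0"
    and lim: "\<And>y. (\<lambda>i. f i y) \<longlonglongrightarrow> f0 y" "(\<lambda>i. g i x) \<longlonglongrightarrow> g0 x" "(\<lambda>i. H i x) \<longlonglongrightarrow> H0 x"
  shows "(\<lambda>i. L (f i) x) \<longlonglongrightarrow> L f0 x"
proof -
  have "(\<lambda>i. LINT y|\<nu>. jump (f i) (g i) x y) \<longlonglongrightarrow> (LINT y|\<nu>. jump f0 g0 x y)"
  proof (rule integral_dominated_convergence)
    show "AE y in \<nu>. (\<lambda>i. jump (f i) (g i) x y) \<longlonglongrightarrow> jump f0 g0 x y"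
      unfolding jump_def by (intro AE_I2 tendsto_intros lim)
    show "AE y in \<nu>. norm (jump (f i) (g i) x y) \<le> 2 * C * min 1 ((norm y)\<^sup>2)" for i
      using jump_bound[OF j(1)] by (intro AE_I2) auto
  qed (intro jump_measurable C2_jetD(3)[OF j(1)] C2_jetD(3)[OF j(2)] integrable_mult_right integrable_levy)+
  thus ?thesis unfolding L_C2_jet[OF j(1)] L_C2_jet[OF j(2)]
    by (intro tendsto_add tendsto_mult_left tendsto_inner tendsto_const lim
        bounded_linear.tendsto[OF bounded_linear_trace_mult])
qed

lemma L_add:
  assumes "C2_jet C f g H" "C2_jet C' f' g' H'"
  shows "L (\<lambda>x. f x + f' x) x = L f x + L f' x"
proof -
  have "jump (\<lambda>x. f x + f' x) (\<lambda>x. g x + g' x) x = (\<lambda>y. jump f g x y + jump f' g' x y)"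
    by (simp add: jump_def inner_add_right algebra_simps fun_eq_iff)
  thus ?thesis
    unfolding L_C2_jet[OF assms(1)] L_C2_jet[OF assms(2)] L_C2_jet[OF C2_jet_add[OF assms]]
    by (simp add: jump_integrable[OF assms(1)] jump_integrable[OF assms(2)] inner_add_right algebra_simps
        linear_add[OF bounded_linear.linear[OF bounded_linear_trace_mult]])
qed

text \<open>The semigroup on Banach-valued functions, needed because the derivatives of
  \<open>P t f\<close> are averages of gradients and Hessians.\<close>

definition PV :: "real \<Rightarrow> (real^'n \<Rightarrow> 'b) \<Rightarrow> real^'n \<Rightarrow> 'b::{banach,second_countable_topology}" where
  "PV t g x = (\<integral>y. g (E t *v x + y) \<partial>\<mu> t)"

lemma P_eq_PV: "P t f x = PV t f x"
  by (simp add: OU_semigroup_def PV_def)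

lemma PV_integrable:
  fixes g :: "real^'n \<Rightarrow> 'b::{banach,second_countable_topology}"
  assumes "0 \<le> t" "continuous_on UNIV g" "\<And>x. norm (g x) \<le> C"
  shows "integrable (\<mu> t) (\<lambda>y. g (z + y))"
proof -
  interpret prob_space "\<mu> t" by (rule law_facts(1)[OF assms(1)])
  show ?thesis
    by (rule integrable_const_bound[of _ C])
       (use assms(3) law_measurable_continuous[OF assms(1,2)] in auto)
qed

lemma PV_tendsto:
  fixes g :: "nat \<Rightarrow> real^'n \<Rightarrow> 'b::{banach,second_countable_topology}"
  assumes "0 \<le> t" "\<And>i. continuous_on UNIV (g i)" "continuous_on UNIV g0" "\<And>i x. norm (g i x) \<le> C"
    "\<And>x. (\<lambda>i. g i x) \<longlonglongrightarrow> g0 x"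
  shows "(\<lambda>i. PV t (g i) x) \<longlonglongrightarrow> PV t g0 x"
proof -
  interpret prob_space "\<mu> t" by (rule law_facts(1)[OF assms(1)])
  show ?thesis unfolding PV_def
    by (rule integral_dominated_convergence[where w = "\<lambda>_. C"])
       (use assms in \<open>auto intro: law_measurable_continuous\<close>)
qed

text \<open>Differentiating under the integral leaves constant matrices on both sides of the
  average, which are pulled out as bounded linear maps. The constant is not enlarged by the
  averaging since \<open>\<mu> t\<close> has mass 1.\<close>

lemma P_C2_jet:
  assumes t: "0 \<le> t" and j: "C2_jet C f g H"
  shows "C2_jet (C * (1 + norm (E t))\<^sup>2) (P t f) (\<lambda>x. transpose (E t) *v PV t g x)
    (\<lambda>x. transpose (E t) ** PV t H x ** E t)"
proof -
  interpret prob_space "\<mu> t" by (rule law_facts(1)[OF t])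
  note d = C2_jetD[OF j]
  have bl: "bounded_linear (\<lambda>X :: real^'n^'n. transpose (E t) ** X ** E t)"
    by (intro bounded_linear_compose[OF bounded_bilinear.bounded_linear_left[OF bounded_bilinear_matrix_matrix_mult]]
        bounded_bilinear.bounded_linear_right[OF bounded_bilinear_matrix_matrix_mult])
  have int: "integrable (\<mu> t) (\<lambda>y. g (z + y))" "integrable (\<mu> t) (\<lambda>y. H (z + y))" for z
    by (rule PV_integrable[OF t, where C = C], rule d, rule d)+
  have m: "(\<lambda>y. transpose (E t) *v g (z + y)) \<in> borel_measurable (\<mu> t)"
    "(\<lambda>y. transpose (E t) ** H (z + y) ** E t) \<in> borel_measurable (\<mu> t)" for z
    by (rule law_measurable_continuous[OF t bounded_linear.continuous_on[OF matrix_vector_mul_bounded_linear d(4)]],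
        rule law_measurable_continuous[OF t bounded_linear.continuous_on[OF bl d(5)]])
  have "C2_jet (\<integral>y. C * (1 + norm (E t))\<^sup>2 \<partial>\<mu> t) (\<lambda>x. \<integral>y. f (E t *v x + y) \<partial>\<mu> t)
     (\<lambda>x. \<integral>y. transpose (E t) *v g (E t *v x + y) \<partial>\<mu> t)
     (\<lambda>x. \<integral>y. transpose (E t) ** H (E t *v x + y) ** E t \<partial>\<mu> t)"
    by (rule C2_jet_integral[OF C2_jet_affine[OF j] _ law_measurable_continuous[OF t d(3)] m]) simp
  thus ?thesis
    unfolding integral_bounded_linear[OF bl int(2)] integral_bounded_linear[OF matrix_vector_mul_bounded_linear int(1)]
    by (simp only: PV_def[abs_def] OU_semigroup_def[abs_def] lebesgue_integral_const prob_space scaleR_one)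
qed

lemma P_bound_uniform: "\<exists>B\<ge>0. \<forall>s\<in>{0..T}. (1 + norm (E s))\<^sup>2 \<le> B"
proof -
  have "compact ((\<lambda>s. (1 + norm (E s))\<^sup>2) ` {0..T})"
    by (intro compact_continuous_image continuous_intros continuous_matrix_exp) auto
  then obtain B where B: "\<forall>y\<in>(\<lambda>s. (1 + norm (E s))\<^sup>2) ` {0..T}. norm y \<le> B"
    by (meson compact_imp_bounded bounded_iff)
  show ?thesis
  \<comment> \<open>For negative \<open>T\<close> the interval is empty and \<open>B\<close> may be
    any number, hence the maximum with 0.\<close>
  proof (intro exI[of _ "max B 0"] conjI ballI)
    fix s assume "s \<in> {0..T}"
    hence "norm ((1 + norm (E s))\<^sup>2) \<le> B" using B by blast
    thus "(1 + norm (E s))\<^sup>2 \<le> max B 0" by simp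
  qed simp
qed

lemma LP_tendsto:
  assumes s: "0 \<le> s" and j: "\<And>i. C2_jet C (f i) (g i) (H i)" "C2_jet C f0 g0 H0"
    and lim: "\<And>y. (\<lambda>i. f i y) \<longlonglongrightarrow> f0 y" "\<And>y. (\<lambda>i. g i y) \<longlonglongrightarrow> g0 y" "\<And>y. (\<lambda>i. H i y) \<longlonglongrightarrow> H0 y"
  shows "(\<lambda>i. L (P s (f i)) x) \<longlonglongrightarrow> L (P s f0) x" "(\<lambda>i. P s (f i) x) \<longlonglongrightarrow> P s f0 x"
proof -
  have f: "(\<lambda>i. P s (f i) x) \<longlonglongrightarrow> P s f0 x" for x
    unfolding P_eq_PV by (rule PV_tendsto[where C = C]) (use s lim C2_jetD[OF j(1)] C2_jetD[OF j(2)] in auto)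
  have g: "(\<lambda>i. PV s (g i) x) \<longlonglongrightarrow> PV s g0 x" for x
    by (rule PV_tendsto[where C = C]) (use s lim C2_jetD[OF j(1)] C2_jetD[OF j(2)] in auto)
  have h: "(\<lambda>i. PV s (H i) x) \<longlonglongrightarrow> PV s H0 x" for x
    by (rule PV_tendsto[where C = C]) (use s lim C2_jetD[OF j(1)] C2_jetD[OF j(2)] in auto)
  show "(\<lambda>i. L (P s (f i)) x) \<longlonglongrightarrow> L (P s f0) x"
    by (rule L_tendsto[OF P_C2_jet[OF s j(1)] P_C2_jet[OF s j(2)] f])
       (intro bounded_bilinear.tendsto[OF bounded_bilinear_matrix_matrix_mult]
          bounded_bilinear.tendsto[OF bounded_bilinear_matrix_vector_mult] tendsto_const g h)+
  show "(\<lambda>i. P s (f i) x) \<longlonglongrightarrow> P s f0 x" by (rule f)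
qed

text \<open>Stated with \<open>has_integral\<close> because integrability of the integrand in s, not
  known beforehand, is part of what passes to limits. The existence of a jet is included so that
  sums can be split by linearity of the operator.\<close>

definition generator_identity :: "(real^'n \<Rightarrow> real) \<Rightarrow> bool" where
  "generator_identity f \<longleftrightarrow> (\<exists>C g H. C2_jet C f g H) \<and>
     (\<forall>x t. 0 \<le> t \<longrightarrow> ((\<lambda>s. L (P s f) x) has_integral (P t f x - f x)) {0..t})"

lemma generator_identity_add:
  assumes "generator_identity f" "generator_identity f'" shows "generator_identity (\<lambda>x. f x + f' x)"
proof -
  obtain C g H C' g' H' where j: "C2_jet C f g H" "C2_jet C' f' g' H'"
    using assms unfolding generator_identity_def by blast
  have P: "P s (\<lambda>x. f x + f' x) = (\<lambda>x. P s f x + P s f' x)" if "0 \<le> s" for s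
    unfolding P_eq_PV PV_def fun_eq_iff using C2_jetD[OF j(1)] C2_jetD[OF j(2)]
    by (auto intro!: Bochner_Integration.integral_add PV_integrable[OF that])
  show ?thesis unfolding generator_identity_def
  proof (intro conjI allI impI)
    show "\<exists>C g H. C2_jet C (\<lambda>x. f x + f' x) g H" using C2_jet_add[OF j] by blast
    fix x and t :: real assume t: "0 \<le> t"
    have "((\<lambda>s. L (P s f) x + L (P s f') x) has_integral (P t f x - f x) + (P t f' x - f' x)) {0..t}"
      using assms t unfolding generator_identity_def by (intro has_integral_add) auto
    also have "(P t f x - f x) + (P t f' x - f' x) = P t (\<lambda>x. f x + f' x) x - (f x + f' x)"
      using t by (simp add: P)
    finally show "((\<lambda>s. L (P s (\<lambda>x. f x + f' x)) x) has_integral P t (\<lambda>x. f x + f' x) x - (f x + f' x)) {0..t}"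
      by (rule has_integral_eq[rotated]) (auto simp: P L_add[OF P_C2_jet[OF _ j(1)] P_C2_jet[OF _ j(2)]])
  qed
qed

text \<open>The engine of all approximations: pointwise convergence of the 2-jets under one constant
  suffices. The same \<open>C\<close> is required of the limit, so constants have to be matched
  before each use.\<close>

lemma generator_identity_limit:
  assumes generator_identity: "\<And>i. generator_identity (f i)" and j: "\<And>i. C2_jet C (f i) (g i) (H i)" "C2_jet C f0 g0 H0"
    and lim: "\<And>y. (\<lambda>i. f i y) \<longlonglongrightarrow> f0 y" "\<And>y. (\<lambda>i. g i y) \<longlonglongrightarrow> g0 y" "\<And>y. (\<lambda>i. H i y) \<longlonglongrightarrow> H0 y"
  shows "generator_identity f0"
  unfolding generator_identity_def
proof (intro conjI allI impI)
  show "\<exists>C g H. C2_jet C f0 g H" using j(2) by blast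
  fix x and t :: real assume t: "0 \<le> t"
  obtain K where K: "K \<ge> 0" "\<And>C f g H. C2_jet C f g H \<Longrightarrow> \<bar>L f x\<bar> \<le> K * C"
    using L_bound by metis
  obtain B where B: "B \<ge> 0" "\<And>s. s \<in> {0..t} \<Longrightarrow> (1 + norm (E s))\<^sup>2 \<le> B"
    using P_bound_uniform by metis
  have hi: "((\<lambda>s. L (P s (f i)) x) has_integral (P t (f i) x - f i x)) {0..t}" for i
    using generator_identity t by (auto simp: generator_identity_def)
  \<comment> \<open>The bound is free of both \<open>s\<close> and \<open>i\<close>, so a constant
    dominates the time integrands.\<close>
  have bnd: "norm (L (P s (f i)) x) \<le> K * (C * B)" if "s \<in> {0..t}" for s i
  proof -
    have "\<bar>L (P s (f i)) x\<bar> \<le> K * (C * (1 + norm (E s))\<^sup>2)"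
      using that by (intro K(2)[OF P_C2_jet[OF _ j(1)]]) auto
    also have "\<dots> \<le> K * (C * B)"
      using that B K C2_jetD(9)[OF j(2)] by (intro mult_left_mono) auto
    finally show ?thesis by simp
  qed
  have ci: "(\<lambda>s. K * (C * B)) integrable_on {0..t}" by (rule integrable_const_ivl)
  have l: "(\<lambda>i. L (P s (f i)) x) \<longlonglongrightarrow> L (P s f0) x" if "s \<in> {0..t}" for s
    using that by (intro LP_tendsto(1)[OF _ j lim]) auto
  have 1: "(\<lambda>s. L (P s f0) x) integrable_on {0..t}"
    by (rule dominated_convergence(1)[OF has_integral_integrable[OF hi] ci bnd l])
  have "(\<lambda>i. integral {0..t} (\<lambda>s. L (P s (f i)) x)) \<longlonglongrightarrow> integral {0..t} (\<lambda>s. L (P s f0) x)"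
    by (rule dominated_convergence(2)[OF has_integral_integrable[OF hi] ci bnd l])
  hence "(\<lambda>i. P t (f i) x - f i x) \<longlonglongrightarrow> integral {0..t} (\<lambda>s. L (P s f0) x)"
    by (simp add: integral_unique[OF hi])
  moreover have "(\<lambda>i. P t (f i) x - f i x) \<longlonglongrightarrow> P t f0 x - f0 x"
    by (intro tendsto_diff LP_tendsto(2)[OF t j lim] lim)
  ultimately show "((\<lambda>s. L (P s f0) x) has_integral (P t f0 x - f0 x)) {0..t}"
    using 1 LIMSEQ_unique has_integral_integrable_integral by blast
qed

section \<open>Exact computation on waves\<close>

lemma levy_kernel_bound:
  "cmod (iexp (u \<bullet> y) - 1 - \<i> * complex_of_real (u \<bullet> y) * csmall y) \<le> (2 + (norm u)\<^sup>2) * min 1 ((norm y)\<^sup>2)"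
proof (cases "norm y \<le> 1")
  case True
  hence *: "(norm y)\<^sup>2 \<le> 1" by (simp add: power_le_one)
  have "(u \<bullet> y)\<^sup>2 \<le> (norm u)\<^sup>2 * (norm y)\<^sup>2"
    using Cauchy_Schwarz_ineq[of u y] by (simp add: power2_norm_eq_inner)
  also have "\<dots> \<le> (2 + (norm u)\<^sup>2) * (norm y)\<^sup>2" by (intro mult_right_mono) auto
  finally show ?thesis
    using order_trans[OF cmod_iexp_diff_le[of "u \<bullet> y"]] True * by simp
next
  case False
  hence *: "1 \<le> (norm y)\<^sup>2" by (simp add: one_le_power)
  have "cmod (iexp (u \<bullet> y) - 1) \<le> 2"
    using norm_triangle_ineq4[of "iexp (u \<bullet> y)" 1] by simp
  thus ?thesis using False * by (simp add: add_increasing2)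
qed

lemma levy_kernel_measurable:
  "(\<lambda>y. iexp (u \<bullet> y) - 1 - \<i> * complex_of_real (u \<bullet> y) * csmall y) \<in> borel_measurable \<nu>"
  by measurable

lemma levy_kernel_integrable:
  "integrable \<nu> (\<lambda>y. iexp (u \<bullet> y) - 1 - \<i> * complex_of_real (u \<bullet> y) * csmall y)"
  by (rule Bochner_Integration.integrable_bound[OF integrable_mult_right[OF integrable_levy, of "2 + (norm u)\<^sup>2"]
        levy_kernel_measurable])
     (use levy_kernel_bound[of u] in \<open>auto intro!: AE_I2 order_trans[OF _ abs_ge_self]\<close>)

lemma continuous_levy_exponent: "continuous_on UNIV \<psi>"
  unfolding continuous_on_sequentially o_def
proof (intro ballI allI impI)
  fix X and u :: "real^'n" assume "(\<forall>n. X n \<in> UNIV) \<and> X \<longlonglongrightarrow> u"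
  hence X: "X \<longlonglongrightarrow> u" by simp
  \<comment> \<open>A convergent sequence of frequencies is bounded, which makes the kernel bound
    uniform along it.\<close>
  obtain B where B: "\<And>n. norm (X n) \<le> B"
    using convergent_imp_bounded[OF X] by (auto simp: bounded_iff)
  have "(\<lambda>i. CLINT y|\<nu>. iexp (X i \<bullet> y) - 1 - \<i> * complex_of_real (X i \<bullet> y) * csmall y) \<longlonglongrightarrow>
     (CLINT y|\<nu>. iexp (u \<bullet> y) - 1 - \<i> * complex_of_real (u \<bullet> y) * csmall y)"
  proof (rule integral_dominated_convergence[OF levy_kernel_measurable levy_kernel_measurable])
    show "integrable \<nu> (\<lambda>y. (2 + B\<^sup>2) * min 1 ((norm y)\<^sup>2))"
      by (intro integrable_mult_right integrable_levy)
    show "AE y in \<nu>. (\<lambda>i. iexp (X i \<bullet> y) - 1 - \<i> * complex_of_real (X i \<bullet> y) * csmall y) \<longlonglongrightarrow>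
        iexp (u \<bullet> y) - 1 - \<i> * complex_of_real (u \<bullet> y) * csmall y"
      by (intro AE_I2 tendsto_intros X)
    show "AE y in \<nu>. norm (iexp (X i \<bullet> y) - 1 - \<i> * complex_of_real (X i \<bullet> y) * csmall y) \<le> (2 + B\<^sup>2) * min 1 ((norm y)\<^sup>2)" for i
    proof (rule AE_I2)
      fix y
      have "(norm (X i))\<^sup>2 \<le> B\<^sup>2" using B by (intro power_mono) auto
      thus "norm (iexp (X i \<bullet> y) - 1 - \<i> * complex_of_real (X i \<bullet> y) * csmall y) \<le> (2 + B\<^sup>2) * min 1 ((norm y)\<^sup>2)"
        by (intro order_trans[OF levy_kernel_bound] mult_right_mono) auto
    qed
  qed
  thus "(\<lambda>i. \<psi> (X i)) \<longlonglongrightarrow> \<psi> u"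
    unfolding levy_exponent_def
    by (intro tendsto_intros X bounded_linear.tendsto[OF matrix_vector_mul_bounded_linear])
qed

definition \<phi> :: "real \<Rightarrow> real^'n \<Rightarrow> complex" where
  "\<phi> t u = exp (- integral {0..t} (\<lambda>s. \<psi> (transpose (E s) *v u)))"

text \<open>A wave is mapped to a wave: its frequency is transported by the transposed exponential
  and its amplitude is multiplied by the characteristic function of \<open>\<mu> t\<close>. The
  complex amplitude \<open>w\<close> treats sines and cosines at once.\<close>

lemma P_trig:
  assumes "0 \<le> t"
  shows "P t (\<lambda>x. Re (w * iexp (u \<bullet> x))) = (\<lambda>x. Re (w * \<phi> t u * iexp ((transpose (E t) *v u) \<bullet> x)))"
proof
  fix x
  interpret prob_space "\<mu> t" by (rule law_facts(1)[OF assms])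
  have m: "(\<lambda>y. complex_of_real (u \<bullet> y)) \<in> borel_measurable (\<mu> t)"
    by (rule law_measurable[OF assms]) measurable
  have int: "integrable (\<mu> t) (\<lambda>y. iexp (u \<bullet> y))"
    by (rule integrable_iexp[OF m]) simp
  have eq: "w * iexp (u \<bullet> (E t *v x + y)) = w * iexp (u \<bullet> (E t *v x)) * iexp (u \<bullet> y)" for y
    by (simp add: inner_add_right distrib_left exp_add mult.assoc)
  have "P t (\<lambda>x. Re (w * iexp (u \<bullet> x))) x = (\<integral>y. Re (w * iexp (u \<bullet> (E t *v x)) * iexp (u \<bullet> y)) \<partial>\<mu> t)"
    by (simp only: OU_semigroup_def eq)
  also have "\<dots> = Re (\<integral>y. w * iexp (u \<bullet> (E t *v x)) * iexp (u \<bullet> y) \<partial>\<mu> t)"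
    by (rule integral_Re) (intro integrable_mult_right int)
  also have "\<dots> = Re (w * iexp (u \<bullet> (E t *v x)) * \<phi> t u)"
    by (simp only: integral_mult_right_zero law_facts(4)[OF assms] \<phi>_def)
  finally show "P t (\<lambda>x. Re (w * iexp (u \<bullet> x))) x = Re (w * \<phi> t u * iexp ((transpose (E t) *v u) \<bullet> x))"
    by (simp add: dot_lmul_matrix vector_transpose_matrix mult_ac)
qed

text \<open>On a wave the operator acts by multiplication with its symbol, which is
  \<open>- \<psi> v\<close> plus the imaginary, x-dependent contribution of the drift.\<close>

lemma L_trig:
  "L (\<lambda>x. Re (w * iexp (v \<bullet> x))) x =
     Re (w * iexp (v \<bullet> x) * (\<i> * complex_of_real ((A *v x) \<bullet> v) - \<psi> v))"
proof -
  let ?z = "w * iexp (v \<bullet> x)"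
  have "jump (\<lambda>x. Re (w * iexp (v \<bullet> x))) (\<lambda>x. Re (\<i> * (w * iexp (v \<bullet> x))) *\<^sub>R v) x y =
     Re (?z * (iexp (v \<bullet> y) - 1 - \<i> * complex_of_real (v \<bullet> y) * csmall y))" for y
  proof -
    have "w * iexp (v \<bullet> (x + y)) = ?z * iexp (v \<bullet> y)"
      by (simp add: inner_add_right distrib_left exp_add mult.assoc)
    moreover have "Re (z * p) - Re z - small y * (y \<bullet> (Re (\<i> * z) *\<^sub>R v)) =
        Re (z * (p - 1 - \<i> * complex_of_real (v \<bullet> y) * csmall y))" for z p
      by (cases "norm y \<le> 1") (simp_all add: inner_commute[of y v] algebra_simps)
    ultimately show ?thesis unfolding jump_def by (simp only:)
  qed
  hence "(LINT y|\<nu>. jump (\<lambda>x. Re (w * iexp (v \<bullet> x))) (\<lambda>x. Re (\<i> * (w * iexp (v \<bullet> x))) *\<^sub>R v) x y) =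
     (LINT y|\<nu>. Re (?z * (iexp (v \<bullet> y) - 1 - \<i> * complex_of_real (v \<bullet> y) * csmall y)))"
    by (simp only:)
  also have "\<dots> = Re (?z * (CLINT y|\<nu>. iexp (v \<bullet> y) - 1 - \<i> * complex_of_real (v \<bullet> y) * csmall y))"
    by (subst integral_Re) (intro integrable_mult_right levy_kernel_integrable, simp only: integral_mult_right_zero)
  finally have J: "(LINT y|\<nu>. jump (\<lambda>x. Re (w * iexp (v \<bullet> x))) (\<lambda>x. Re (\<i> * (w * iexp (v \<bullet> x))) *\<^sub>R v) x y) =
     Re (?z * (CLINT y|\<nu>. iexp (v \<bullet> y) - 1 - \<i> * complex_of_real (v \<bullet> y) * csmall y))" .
  define I where "I = (CLINT y|\<nu>. iexp (v \<bullet> y) - 1 - \<i> * complex_of_real (v \<bullet> y) * csmall y)"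
  define z where "z = ?z"
  have T: "trace (Q ** (r *\<^sub>R outer_product v v)) = r * ((Q *v v) \<bullet> v)" for r
    by (simp add: linear_cmul[OF bounded_linear.linear[OF bounded_linear_trace_mult]] trace_outer_product)
  show ?thesis
    unfolding L_C2_jet[OF C2_jet_trig] J levy_exponent_def I_def[symmetric] z_def[symmetric] T
    by (simp add: algebra_simps)
qed

lemma generator_identity_trig: "generator_identity (\<lambda>x. Re (w * iexp (u \<bullet> x)))"
  unfolding generator_identity_def
proof (intro conjI allI impI)
  show "\<exists>C g H. C2_jet C (\<lambda>x. Re (w * iexp (u \<bullet> x))) g H" using C2_jet_trig by blast
  fix x and t :: real assume t: "0 \<le> t"
  define v where "v s = transpose (E s) *v u" for s
  define F where "F s = Re (w * (\<phi> s u * iexp (v s \<bullet> x)))" for s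
  have cont: "continuous_on {0..t} (\<lambda>s. \<psi> (v s))"
    unfolding v_def
    by (rule continuous_on_compose2[OF continuous_levy_exponent _ subset_UNIV])
       (intro bounded_bilinear.continuous_on[OF bounded_bilinear_matrix_vector_mult]
         bounded_linear.continuous_on[OF bounded_linear_transpose] continuous_matrix_exp continuous_on_const)
  have "(F has_vector_derivative L (P s (\<lambda>x. Re (w * iexp (u \<bullet> x)))) x) (at s within {0..t})"
    if s: "s \<in> {0..t}" for s
  proof -
    \<comment> \<open>The logarithm of the evolved wave without \<open>w\<close>. Its derivative in
      s, \<open>- \<psi> (v s)\<close> plus the drift term, is exactly the symbol of the operator at
      the transported frequency \<open>v s\<close>.\<close>
    define \<theta> where "\<theta> s = - integral {0..s} (\<lambda>s. \<psi> (v s)) + \<i> * complex_of_real (v s \<bullet> x)" for s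
    have v: "v s \<bullet> y = u \<bullet> (E s *v y)" for s y
      by (simp add: v_def dot_lmul_matrix vector_transpose_matrix)
    have 1: "((\<lambda>s. v s \<bullet> x) has_field_derivative (v s \<bullet> (A *v x))) (at s within {0..t})"
      unfolding v
      by (rule has_field_derivative_at_within[OF inner_matrix_exp_has_field_derivative])
    have 2: "((\<lambda>s. \<i> * complex_of_real (v s \<bullet> x)) has_vector_derivative \<i> * complex_of_real (v s \<bullet> (A *v x))) (at s within {0..t})"
      by (intro has_vector_derivative_mult_right has_vector_derivative_of_real 1)
    have 3: "(\<theta> has_vector_derivative - \<psi> (v s) + \<i> * complex_of_real (v s \<bullet> (A *v x))) (at s within {0..t})"
      unfolding \<theta>_def
      by (intro has_vector_derivative_add has_vector_derivative_minus 2 integral_has_vector_derivative[OF cont s])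
    have "((exp \<circ> \<theta>) has_vector_derivative (- \<psi> (v s) + \<i> * complex_of_real (v s \<bullet> (A *v x))) * exp (\<theta> s)) (at s within {0..t})"
      by (rule field_vector_diff_chain_within[OF 3 has_field_derivative_at_within[OF DERIV_exp]])
    hence "((\<lambda>s. w * (exp \<circ> \<theta>) s) has_vector_derivative w * ((- \<psi> (v s) + \<i> * complex_of_real (v s \<bullet> (A *v x))) * exp (\<theta> s))) (at s within {0..t})"
      by (rule has_vector_derivative_mult_right)
    hence "((\<lambda>s. Re (w * (exp \<circ> \<theta>) s)) has_vector_derivative Re (w * ((- \<psi> (v s) + \<i> * complex_of_real (v s \<bullet> (A *v x))) * exp (\<theta> s)))) (at s within {0..t})"
      by (rule bounded_linear.has_vector_derivative[OF bounded_linear_Re])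
    moreover have "(\<lambda>s. Re (w * (exp \<circ> \<theta>) s)) = F"
      by (rule ext) (simp only: F_def \<theta>_def o_def exp_add \<phi>_def v_def)
    moreover have "exp (\<theta> s) = \<phi> s u * iexp (v s \<bullet> x)"
      by (simp only: \<theta>_def exp_add \<phi>_def v_def)
    hence "w * ((- \<psi> (v s) + \<i> * complex_of_real (v s \<bullet> (A *v x))) * exp (\<theta> s)) =
        w * \<phi> s u * iexp (v s \<bullet> x) * (\<i> * complex_of_real ((A *v x) \<bullet> v s) - \<psi> (v s))"
      by (simp only: inner_commute[of "A *v x"]) (simp add: mult_ac)
    moreover have "L (P s (\<lambda>x. Re (w * iexp (u \<bullet> x)))) x =
        Re (w * \<phi> s u * iexp (v s \<bullet> x) * (\<i> * complex_of_real ((A *v x) \<bullet> v s) - \<psi> (v s)))"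
      using s by (simp only: atLeastAtMost_iff P_trig L_trig v_def)
    ultimately show ?thesis by (simp only:)
  qed
  hence "((\<lambda>s. L (P s (\<lambda>x. Re (w * iexp (u \<bullet> x)))) x) has_integral F t - F 0) {0..t}"
    by (intro fundamental_theorem_of_calculus t)
  moreover have "F t = P t (\<lambda>x. Re (w * iexp (u \<bullet> x))) x"
    using t by (simp only: P_trig F_def v_def mult.assoc)
  moreover have "F 0 = Re (w * iexp (u \<bullet> x))"
    by (simp add: F_def \<phi>_def v_def matrix_exp_0 transpose_mat)
  ultimately show "((\<lambda>s. L (P s (\<lambda>x. Re (w * iexp (u \<bullet> x)))) x) has_integral
      P t (\<lambda>x. Re (w * iexp (u \<bullet> x))) x - Re (w * iexp (u \<bullet> x))) {0..t}"
    by (simp only:)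
qed

end

section \<open>A trigonometric kernel approximating the Gaussian\<close>

text \<open>Replace \<open>Suc n\<close> copies of \<open>t ^ n\<close> by the larger geometric sum,
  which telescopes against \<open>1 - t\<close>.\<close>

lemma Suc_mult_power_le_one:
  fixes t :: real assumes "0 \<le> t" "t \<le> 1"
  shows "real (Suc n) * t ^ n * (1 - t) \<le> 1"
proof -
  have "real (Suc n) * t ^ n = (\<Sum>k<Suc n. t ^ n)" by simp
  also have "\<dots> \<le> (\<Sum>k<Suc n. t ^ k)"
    using assms by (intro sum_mono power_decreasing) auto
  finally have "real (Suc n) * t ^ n * (1 - t) \<le> (\<Sum>k<Suc n. t ^ k) * (1 - t)"
    using assms by (intro mult_right_mono) auto
  also have "\<dots> = 1 - t ^ Suc n"
    by (subst one_diff_power_eq) (simp add: mult.commute)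
  finally show ?thesis using assms zero_le_power[of t "Suc n"] by linarith
qed

text \<open>The hypothesis \<open>|g|\<^sup>2 \<le> 1 - q\<^sup>2\<close> is what keeps the jet bounded in \<open>m\<close>: differentiating the power
produces factors of order \<open>m\<close>, and \<open>n t\<^sup>n (1 - t)\<close> is bounded on \<open>[0, 1]\<close>.\<close>

lemma C2_jet_power_scaled:
  fixes q :: "real^'n \<Rightarrow> real" and m :: nat
  assumes q: "\<And>x. (q has_derivative (\<lambda>h. g x \<bullet> h)) (at x)" "\<And>x. (g has_derivative (\<lambda>h. H x *v h)) (at x)"
    "continuous_on UNIV H" "\<And>x. \<bar>q x\<bar> \<le> 1" "\<And>x. (norm (g x))\<^sup>2 \<le> 1 - (q x)\<^sup>2" "\<And>x. norm (H x) \<le> B"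
  defines "N \<equiv> real (m + 2)"
  shows "C2_jet (B + 3) (\<lambda>z. q ((1 / sqrt N) *\<^sub>R z) ^ (m + 2))
    (\<lambda>z. q ((1 / sqrt N) *\<^sub>R z) ^ (m + 1) *\<^sub>R (sqrt N *\<^sub>R g ((1 / sqrt N) *\<^sub>R z)))
    (\<lambda>z. q ((1 / sqrt N) *\<^sub>R z) ^ (m + 1) *\<^sub>R H ((1 / sqrt N) *\<^sub>R z) +
       ((real (m + 1) / N) * q ((1 / sqrt N) *\<^sub>R z) ^ m) *\<^sub>R
         outer_product (sqrt N *\<^sub>R g ((1 / sqrt N) *\<^sub>R z)) (sqrt N *\<^sub>R g ((1 / sqrt N) *\<^sub>R z)))"
proof -
  define c where "c = 1 / sqrt N"
  have N: "N > 0" by (simp add: N_def)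
  have c: "c > 0" "c * c * N = 1" "N * c = sqrt N" "sqrt N * c = 1"
    using N by (auto simp: c_def field_simps real_sqrt_mult[symmetric])
  have B: "0 \<le> B" using q(6) norm_ge_zero order_trans by blast
  have dc: "((\<lambda>z. c *\<^sub>R z) has_derivative (\<lambda>h. c *\<^sub>R h)) (at z)" for z :: "real^'n"
    by (auto intro!: derivative_eq_intros)
  have dq: "((\<lambda>z. q (c *\<^sub>R z)) has_derivative (\<lambda>h. c * (g (c *\<^sub>R z) \<bullet> h))) (at z)" for z
    using has_derivative_compose[OF dc q(1)] by simp
  have dg: "((\<lambda>z. g (c *\<^sub>R z)) has_derivative (\<lambda>h. c *\<^sub>R (H (c *\<^sub>R z) *v h))) (at z)" for z
    using has_derivative_compose[OF dc q(2)] by (simp add: matrix_vector_mult_scaleR)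
  have cH: "continuous_on UNIV (\<lambda>z. H (c *\<^sub>R z))" "continuous_on UNIV (\<lambda>z. q (c *\<^sub>R z))" "continuous_on UNIV (\<lambda>z. g (c *\<^sub>R z))"
    by (rule continuous_on_compose2[OF q(3) _ subset_UNIV], intro continuous_intros)
       (auto intro!: continuous_at_imp_continuous_on has_derivative_continuous dq dg)
  show ?thesis unfolding c_def[symmetric]
  proof (rule C2_jetI)
    fix z
    show "((\<lambda>z. q (c *\<^sub>R z) ^ (m + 2)) has_derivative
        (\<lambda>h. (q (c *\<^sub>R z) ^ (m + 1) *\<^sub>R (sqrt N *\<^sub>R g (c *\<^sub>R z))) \<bullet> h)) (at z)"
    proof (rule has_derivative_eq_rhs[OF has_derivative_power[OF dq]])
      have s: "sqrt N = real (m + 2) * c" using c(3) by (simp add: N_def)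
      show "(\<lambda>h. of_nat (m + 2) * (c * (g (c *\<^sub>R z) \<bullet> h)) * q (c *\<^sub>R z) ^ (m + 2 - 1)) =
          (\<bullet>) (q (c *\<^sub>R z) ^ (m + 1) *\<^sub>R sqrt N *\<^sub>R g (c *\<^sub>R z))"
        by (simp add: fun_eq_iff s)
    qed
    show "((\<lambda>z. q (c *\<^sub>R z) ^ (m + 1) *\<^sub>R (sqrt N *\<^sub>R g (c *\<^sub>R z))) has_derivative
        (\<lambda>h. (q (c *\<^sub>R z) ^ (m + 1) *\<^sub>R H (c *\<^sub>R z) +
           ((real (m + 1) / N) * q (c *\<^sub>R z) ^ m) *\<^sub>R
             outer_product (sqrt N *\<^sub>R g (c *\<^sub>R z)) (sqrt N *\<^sub>R g (c *\<^sub>R z))) *v h)) (at z)"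
    proof (rule has_derivative_eq_rhs[OF has_derivative_scaleR[OF has_derivative_power[OF dq] has_derivative_scaleR_right[OF dg]]])
      have cN: "c * sqrt N = 1" "sqrt N * sqrt N = N" using c N by (auto simp: mult.commute)
      have a: "sqrt N *\<^sub>R c *\<^sub>R v = v" for v :: "real^'n" by (simp add: c(4))
      have b: "(of_nat k * (c * y) * p) *\<^sub>R sqrt N *\<^sub>R v =
          (real k / N * p) *\<^sub>R ((sqrt N * y) *\<^sub>R sqrt N *\<^sub>R v)" for k y p and v :: "real^'n"
      proof -
        have "of_nat k * (c * y) * p * sqrt N = real k * y * p * (c * sqrt N)" by (simp add: mult_ac)
        also have "\<dots> = real k / N * p * (y * (sqrt N * sqrt N))" using N by (simp only: cN) simp
        finally show ?thesis by (simp add: mult_ac)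
      qed
      show "(\<lambda>h. q (c *\<^sub>R z) ^ (m + 1) *\<^sub>R sqrt N *\<^sub>R c *\<^sub>R (H (c *\<^sub>R z) *v h) +
            (of_nat (m + 1) * (c * (g (c *\<^sub>R z) \<bullet> h)) * q (c *\<^sub>R z) ^ (m + 1 - 1)) *\<^sub>R sqrt N *\<^sub>R g (c *\<^sub>R z)) =
          (*v) (q (c *\<^sub>R z) ^ (m + 1) *\<^sub>R H (c *\<^sub>R z) +
            ((real (m + 1) / N) * q (c *\<^sub>R z) ^ m) *\<^sub>R
              outer_product (sqrt N *\<^sub>R g (c *\<^sub>R z)) (sqrt N *\<^sub>R g (c *\<^sub>R z)))"
        by (rule ext) (simp only: a b matrix_vector_mult_add_rdistrib outer_product_mult
            scaleR_matrix_vector_assoc[symmetric] inner_scaleR_left add_diff_cancel_right')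
    qed
    define Q where "Q = q (c *\<^sub>R z)"
    define t where "t = \<bar>Q\<bar>"
    have t: "0 \<le> t" "t \<le> 1" "Q\<^sup>2 = t\<^sup>2" using q(4) by (auto simp: t_def Q_def)
    have tp: "t ^ k \<le> 1" for k using t by (simp add: power_le_one)
    show "\<bar>q (c *\<^sub>R z) ^ (m + 2)\<bar> \<le> B + 3"
      using tp[of "m+2"] B unfolding power_abs t_def Q_def by simp
    have n2: "(norm (sqrt N *\<^sub>R g (c *\<^sub>R z)))\<^sup>2 \<le> N * (1 - t\<^sup>2)"
      using mult_left_mono[OF q(5)[of "c *\<^sub>R z"], of N] N t(3)
      by (simp add: power_mult_distrib Q_def)
    have "(norm (q (c *\<^sub>R z) ^ (m + 1) *\<^sub>R (sqrt N *\<^sub>R g (c *\<^sub>R z))))\<^sup>2 =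
        (t ^ (m+1))\<^sup>2 * (norm (sqrt N *\<^sub>R g (c *\<^sub>R z)))\<^sup>2"
      by (simp only: norm_scaleR[of "q (c *\<^sub>R z) ^ (m + 1)"] power_abs t_def Q_def power_mult_distrib)
    also have "\<dots> \<le> (t ^ (m+1))\<^sup>2 * (N * (1 - t\<^sup>2))" by (intro mult_left_mono n2) simp
    \<comment> \<open>Here \<open>N\<close> is \<open>Suc (m + 1)\<close>, so the elementary
      inequality applies to the square of \<open>t\<close> with exponent
      \<open>m + 1\<close>.\<close>
    also have "\<dots> = real (Suc (m + 1)) * (t\<^sup>2) ^ (m + 1) * (1 - t\<^sup>2)"
      by (simp add: N_def power_mult[symmetric] mult_ac del: power_Suc)
    also have "\<dots> \<le> 1" using t tp[of 2] by (intro Suc_mult_power_le_one) auto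
    finally have "norm (q (c *\<^sub>R z) ^ (m + 1) *\<^sub>R (sqrt N *\<^sub>R g (c *\<^sub>R z))) \<le> 1"
      by (simp add: power_le_one_iff abs_square_le_1)
    thus "norm (q (c *\<^sub>R z) ^ (m + 1) *\<^sub>R (sqrt N *\<^sub>R g (c *\<^sub>R z))) \<le> B + 3" using B by linarith
    have 1: "norm (q (c *\<^sub>R z) ^ (m + 1) *\<^sub>R H (c *\<^sub>R z)) \<le> 1 * B"
      unfolding norm_scaleR
      by (intro mult_mono q(6)) (use tp[of "m+1"] in \<open>auto simp: power_abs t_def Q_def simp del: power_Suc\<close>)
    have "norm (((real (m + 1) / N) * q (c *\<^sub>R z) ^ m) *\<^sub>R
         outer_product (sqrt N *\<^sub>R g (c *\<^sub>R z)) (sqrt N *\<^sub>R g (c *\<^sub>R z))) =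
       (real (m + 1) / N * t ^ m) * (norm (sqrt N *\<^sub>R g (c *\<^sub>R z)))\<^sup>2"
      unfolding norm_scaleR[of "(real (m + 1) / N) * q (c *\<^sub>R z) ^ m"] norm_outer_product
      using N by (simp add: abs_mult power_abs t_def Q_def power2_eq_square)
    also have "\<dots> \<le> (real (m + 1) / N * t ^ m) * (N * (1 - t\<^sup>2))"
      using N t by (intro mult_left_mono n2) auto
    \<comment> \<open>Splitting \<open>1 - t\<^sup>2\<close> leaves the elementary inequality times
      \<open>1 + t \<le> 2\<close>; with \<open>B\<close> from the other summand the Hessian is
      bounded by \<open>B + 2\<close>.\<close>
    also have "\<dots> = (real (Suc m) * t ^ m * (1 - t)) * (1 + t)"
      using N by (simp add: field_simps power2_eq_square)
    also have "\<dots> \<le> 1 * 2"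
      using t by (intro mult_mono Suc_mult_power_le_one) auto
    finally show "norm (q (c *\<^sub>R z) ^ (m + 1) *\<^sub>R H (c *\<^sub>R z) + ((real (m + 1) / N) * q (c *\<^sub>R z) ^ m) *\<^sub>R
         outer_product (sqrt N *\<^sub>R g (c *\<^sub>R z)) (sqrt N *\<^sub>R g (c *\<^sub>R z))) \<le> B + 3"
      by (intro order_trans[OF norm_triangle_ineq]) (use 1 in linarith)
  qed (intro continuous_intros cH)
qed

text \<open>The frequency, the square root of the dimension, compensates the averaging: near 0 the
  function is 1 minus half the squared norm up to higher order, so its rescaled powers tend to the
  standard Gaussian profile.\<close>

definition cos_mean :: "real^'n \<Rightarrow> real" where
  "cos_mean z = (1 / CARD('n)) * (\<Sum>i\<in>UNIV. cos (sqrt (CARD('n)) * z $ i))"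

definition cos_mean_grad :: "real^'n \<Rightarrow> real^'n" where
  "cos_mean_grad z = (\<chi> i. - (1 / sqrt (CARD('n))) * sin (sqrt (CARD('n)) * z $ i))"

definition cos_mean_hess :: "real^'n \<Rightarrow> real^'n^'n" where
  "cos_mean_hess z = (\<chi> i j. if i = j then - cos (sqrt (CARD('n)) * z $ i) else 0)"

lemma has_derivative_cos_mean:
  fixes z :: "real^'n"
  shows "(cos_mean has_derivative (\<lambda>h. cos_mean_grad z \<bullet> h)) (at z)"
proof -
  define r where "r = sqrt (real CARD('n))"
  have r: "r > 0" "real CARD('n) = r * r" by (auto simp: r_def)
  have "((\<lambda>z :: real^'n. (1 / (r * r)) * (\<Sum>i\<in>UNIV. cos (r * z $ i))) has_derivative
      (\<lambda>h. (1 / (r * r)) * (\<Sum>i\<in>UNIV. - sin (r * z $ i) * (r * h $ i)))) (at z)"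
    by (intro has_derivative_mult_right has_derivative_sum)
       (auto intro!: derivative_eq_intros bounded_linear_imp_has_derivative[OF bounded_linear_vec_nth] simp: fun_eq_iff)
  also have "(\<lambda>h. (1 / (r * r)) * (\<Sum>i\<in>UNIV. - sin (r * z $ i) * (r * h $ i))) = (\<lambda>h. cos_mean_grad z \<bullet> h)"
    unfolding cos_mean_grad_def r_def[symmetric] inner_vec_def sum_distrib_left
    using r(1) by (auto simp: fun_eq_iff field_simps intro!: sum.cong)
  finally show ?thesis unfolding cos_mean_def[abs_def] r_def[symmetric] unfolding r(2) .
qed

lemma has_derivative_cos_mean_grad:
  fixes z :: "real^'n"
  shows "(cos_mean_grad has_derivative (\<lambda>h. cos_mean_hess z *v h)) (at z)"
proof -
  define r where "r = sqrt (real CARD('n))"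
  have r: "r > 0" by (auto simp: r_def)
  have *: "(cos_mean_hess z *v h) $ i = - cos (sqrt (CARD('n)) * z $ i) * h $ i" for h and i :: 'n
    by (simp add: cos_mean_hess_def matrix_vector_mult_def if_distrib[of "\<lambda>x. x * _"] cong: if_cong)
  have "((\<lambda>z. cos_mean_grad z $ i) has_derivative (\<lambda>h. (cos_mean_hess z *v h) $ i)) (at z)" for i
    unfolding * cos_mean_grad_def r_def[symmetric] using r
    by (auto intro!: derivative_eq_intros bounded_linear_imp_has_derivative[OF bounded_linear_vec_nth] simp: fun_eq_iff)
  thus ?thesis
    by (subst has_derivative_componentwise_within) (auto simp: Basis_vec_def inner_axis)
qed

text \<open>The squared gradient is the mean of the squared sines, that is 1 minus the mean of the
  squared cosines, and Cauchy-Schwarz bounds the squared mean by the mean of squares. The Hessian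
  bound sums rows of norm at most 1.\<close>

lemma cos_mean_bounds:
  fixes z :: "real^'n"
  shows "\<bar>cos_mean z\<bar> \<le> 1" "(norm (cos_mean_grad z))\<^sup>2 \<le> 1 - (cos_mean z)\<^sup>2" "norm (cos_mean_hess z) \<le> CARD('n)"
proof -
  let ?d = "real CARD('n)" and ?c = "\<lambda>i. cos (sqrt (CARD('n)) * z $ i)"
  have "\<bar>\<Sum>i\<in>UNIV. ?c i\<bar> \<le> (\<Sum>i\<in>(UNIV::'n set). 1)"
    by (rule order_trans[OF sum_abs sum_mono]) simp
  thus "\<bar>cos_mean z\<bar> \<le> 1" by (simp add: cos_mean_def abs_mult field_simps)
  have n: "(norm (cos_mean_grad z))\<^sup>2 = (1 / ?d) * (\<Sum>i\<in>UNIV. 1 - (?c i)\<^sup>2)"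
    by (simp add: power2_norm_eq_inner inner_vec_def cos_mean_grad_def sum_distrib_left sin_squared_eq[symmetric] power2_eq_square[symmetric] power_mult_distrib power_divide)
  have "(\<Sum>i\<in>UNIV. ?c i)\<^sup>2 \<le> ?d * (\<Sum>i\<in>UNIV. (?c i)\<^sup>2)"
    using sum_squared_le_sum_of_squares[of ?c UNIV] by (simp add: mult.commute)
  hence "(cos_mean z)\<^sup>2 \<le> (1 / ?d) * (\<Sum>i\<in>UNIV. (?c i)\<^sup>2)"
    by (simp add: cos_mean_def power2_eq_square field_simps)
  thus "(norm (cos_mean_grad z))\<^sup>2 \<le> 1 - (cos_mean z)\<^sup>2"
    unfolding n by (simp add: sum_subtractf right_diff_distrib)
  have "norm (cos_mean_hess z) \<le> (\<Sum>i\<in>UNIV. norm (cos_mean_hess z $ i))"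
    unfolding norm_vec_def[of "cos_mean_hess z"] by (rule L2_set_le_sum) simp
  also have "\<dots> \<le> (\<Sum>i\<in>(UNIV::'n set). 1)"
  proof (rule sum_mono)
    fix i
    have "cos_mean_hess z $ i = (- ?c i) *\<^sub>R axis i 1"
      by (simp add: vec_eq_iff cos_mean_hess_def axis_def)
    thus "norm (cos_mean_hess z $ i) \<le> 1" by simp
  qed
  finally show "norm (cos_mean_hess z) \<le> CARD('n)" by simp
qed

definition gauss :: "real^'n \<Rightarrow> real" where
  "gauss z = exp (- ((norm z)\<^sup>2 / 2))"

definition gauss_hess :: "real^'n \<Rightarrow> real^'n^'n" where
  "gauss_hess z = gauss z *\<^sub>R (outer_product z z - mat 1)"

lemma filterlim_real_add_2: "filterlim (\<lambda>m. real (m + 2)) at_top sequentially"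
  by real_asymp

lemma tendsto_cos_scaled: "(\<lambda>m. real (m + 2) * (cos (y * (1 / sqrt (real (m + 2)))) - 1)) \<longlonglongrightarrow> - (y * y / 2)"
proof (cases "y = 0")
  case False
  have "((\<lambda>x. x * (cos (y * (1 / sqrt x)) - 1)) \<longlongrightarrow> - (y * y / 2)) at_top"
    using False by real_asymp
  from filterlim_compose[OF this filterlim_real_add_2] show ?thesis .
qed auto

lemma tendsto_sin_scaled: "(\<lambda>m. sqrt (real (m + 2)) * sin (y * (1 / sqrt (real (m + 2))))) \<longlonglongrightarrow> y"
proof (cases "y = 0")
  case False
  have "((\<lambda>x. sqrt x * sin (y * (1 / sqrt x))) \<longlongrightarrow> y) at_top"
    using False by real_asymp
  from filterlim_compose[OF this filterlim_real_add_2] show ?thesis .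
qed auto

text \<open>Compare with exact roots of the exponential: for numbers in the unit interval, k-th
  powers differ by at most k times the difference of the bases. No logarithm is taken, so
  \<open>q m\<close> may be negative. The shift \<open>j \<le> 2\<close> covers the exponents
  \<open>m\<close>, \<open>m + 1\<close> and \<open>m + 2\<close> that occur in a jet.\<close>

lemma tendsto_power_exp:
  fixes q :: "nat \<Rightarrow> real"
  assumes q: "\<And>m. \<bar>q m\<bar> \<le> 1" "(\<lambda>m. real (m + 2) * (q m - 1)) \<longlonglongrightarrow> l" and l: "l \<le> 0" and j: "j \<le> 2"
  shows "(\<lambda>m. q m ^ (m + j)) \<longlonglongrightarrow> exp l"
proof -
  define w where "w m = exp (l / real (m + 2))" for m
  have "((\<lambda>x. x * (exp (l / x) - 1)) \<longlongrightarrow> l) at_top"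
  proof (cases "l = 0")
    case False thus ?thesis by real_asymp
  qed auto
  from filterlim_compose[OF this filterlim_real_add_2]
  have w: "(\<lambda>m. real (m + 2) * (w m - 1)) \<longlonglongrightarrow> l" by (simp add: w_def)
  have lim: "(\<lambda>m. \<bar>real (m + 2) * (q m - 1) - real (m + 2) * (w m - 1)\<bar>) \<longlonglongrightarrow> 0"
    using tendsto_rabs[OF tendsto_diff[OF q(2) w]] by simp
  have "(\<lambda>m. q m ^ (m + j) - w m ^ (m + j)) \<longlonglongrightarrow> 0"
  proof (rule Lim_null_comparison[OF _ lim], intro always_eventually allI)
    fix m
    have "\<bar>w m\<bar> \<le> 1" using l by (simp add: w_def divide_nonpos_pos)
    hence "norm (q m ^ (m + j) - w m ^ (m + j)) \<le> real (m + j) * norm (q m - w m)"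
      using q(1) by (intro norm_power_diff) auto
    also have "\<dots> \<le> real (m + 2) * norm (q m - w m)" using j by (intro mult_right_mono) auto
    also have "\<dots> = \<bar>real (m + 2) * (q m - w m)\<bar>" by (simp add: abs_mult)
    finally show "norm (q m ^ (m + j) - w m ^ (m + j)) \<le> \<bar>real (m + 2) * (q m - 1) - real (m + 2) * (w m - 1)\<bar>"
      by (simp add: algebra_simps)
  qed
  moreover have "(\<lambda>m. w m ^ (m + j)) \<longlonglongrightarrow> exp l"
  proof -
    have "(\<lambda>m. real (m + j) / real (m + 2)) \<longlonglongrightarrow> 1" by real_asymp
    hence "(\<lambda>m. exp (l * (real (m + j) / real (m + 2)))) \<longlonglongrightarrow> exp (l * 1)"
      by (intro tendsto_intros)
    moreover have "w m ^ (m + j) = exp (l * (real (m + j) / real (m + 2)))" for m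
      by (simp add: w_def exp_of_nat_mult[symmetric] mult_ac)
    ultimately show ?thesis by simp
  qed
  ultimately show ?thesis using tendsto_add by fastforce
qed

text \<open>The exponent starts at 2 so that two differentiations still leave a natural power, down
  to \<open>m\<close>. The two definitions that follow are the derivatives in the form delivered by
  \<open>C2_jet_power_scaled\<close>.\<close>

definition kern :: "nat \<Rightarrow> real^'n \<Rightarrow> real" where
  "kern m z = cos_mean ((1 / sqrt (real (m + 2))) *\<^sub>R z) ^ (m + 2)"

definition kern_grad :: "nat \<Rightarrow> real^'n \<Rightarrow> real^'n" where
  "kern_grad m z = cos_mean ((1 / sqrt (real (m + 2))) *\<^sub>R z) ^ (m + 1) *\<^sub>R
     (sqrt (real (m + 2)) *\<^sub>R cos_mean_grad ((1 / sqrt (real (m + 2))) *\<^sub>R z))"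

definition kern_hess :: "nat \<Rightarrow> real^'n \<Rightarrow> real^'n^'n" where
  "kern_hess m z = cos_mean ((1 / sqrt (real (m + 2))) *\<^sub>R z) ^ (m + 1) *\<^sub>R cos_mean_hess ((1 / sqrt (real (m + 2))) *\<^sub>R z) +
     ((real (m + 1) / real (m + 2)) * cos_mean ((1 / sqrt (real (m + 2))) *\<^sub>R z) ^ m) *\<^sub>R
       outer_product (sqrt (real (m + 2)) *\<^sub>R cos_mean_grad ((1 / sqrt (real (m + 2))) *\<^sub>R z))
         (sqrt (real (m + 2)) *\<^sub>R cos_mean_grad ((1 / sqrt (real (m + 2))) *\<^sub>R z))"

lemma C2_jet_kern: "C2_jet (real CARD('n) + 3) (kern m :: real^'n \<Rightarrow> real) (kern_grad m) (kern_hess m)"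
proof -
  have "continuous_on UNIV (cos_mean_hess :: real^'n \<Rightarrow> _)"
    unfolding cos_mean_hess_def
  proof (intro continuous_on_vec_lambda)
    fix i j :: 'n
    show "continuous_on UNIV (\<lambda>x :: real^'n. if i = j then - cos (sqrt (CARD('n)) * x $ i) else 0)"
      by (cases "i = j") (auto intro!: continuous_intros)
  qed
  from C2_jet_power_scaled[OF has_derivative_cos_mean has_derivative_cos_mean_grad this cos_mean_bounds, of m]
  show ?thesis unfolding kern_def[abs_def] kern_grad_def[abs_def] kern_hess_def[abs_def] .
qed

lemma kern_tendsto:
  fixes z :: "real^'n"
  shows "(\<lambda>m. kern m z) \<longlonglongrightarrow> gauss z" "(\<lambda>m. kern_grad m z) \<longlonglongrightarrow> - gauss z *\<^sub>R z"
    "(\<lambda>m. kern_hess m z) \<longlonglongrightarrow> gauss_hess z"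
proof -
  let ?d = "sqrt (real CARD('n))" and ?z = "\<lambda>m::nat. (1 / sqrt (real (m + 2))) *\<^sub>R z"
  have "(\<lambda>m. (1 / real CARD('n)) * (\<Sum>i\<in>UNIV. real (m + 2) * (cos ((?d * z $ i) * (1 / sqrt (real (m + 2)))) - 1)))
      \<longlonglongrightarrow> (1 / real CARD('n)) * (\<Sum>i\<in>UNIV. - ((?d * z $ i) * (?d * z $ i) / 2))"
    by (intro tendsto_mult_left tendsto_sum tendsto_cos_scaled)
  also have "(1 / real CARD('n)) * (\<Sum>i\<in>UNIV. - ((?d * z $ i) * (?d * z $ i) / 2)) = - ((norm z)\<^sup>2 / 2)"
  proof -
    have "(?d * z $ i) * (?d * z $ i) = real CARD('n) * (z $ i * z $ i)" for i by simp
    thus ?thesis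
      by (simp only: power2_norm_eq_inner inner_vec_def inner_real_def sum_negf sum_divide_distrib[symmetric] sum_distrib_left[symmetric]) simp
  qed
  also have "(\<lambda>m. (1 / real CARD('n)) * (\<Sum>i\<in>UNIV. real (m + 2) * (cos ((?d * z $ i) * (1 / sqrt (real (m + 2)))) - 1)))
      = (\<lambda>m. real (m + 2) * (cos_mean (?z m) - 1))"
  proof
    fix m :: nat
    have "(1 / real CARD('n)) * (\<Sum>i\<in>UNIV. N * (c i - 1)) = N * ((1 / real CARD('n)) * (\<Sum>i\<in>UNIV. c i) - 1)"
      for N and c :: "'n \<Rightarrow> real"
      by (simp only: sum_distrib_left[symmetric] sum_subtractf) (simp add: field_simps)
    thus "(1 / real CARD('n)) * (\<Sum>i\<in>UNIV. real (m + 2) * (cos ((?d * z $ i) * (1 / sqrt (real (m + 2)))) - 1)) =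
        real (m + 2) * (cos_mean (?z m) - 1)"
      by (simp add: cos_mean_def mult_ac)
  qed
  finally have q: "(\<lambda>m. real (m + 2) * (cos_mean (?z m) - 1)) \<longlonglongrightarrow> - ((norm z)\<^sup>2 / 2)" .
  have pw: "(\<lambda>m. cos_mean (?z m) ^ (m + j)) \<longlonglongrightarrow> gauss z" if "j \<le> 2" for j
    unfolding gauss_def by (rule tendsto_power_exp[OF cos_mean_bounds(1) q _ that]) simp
  show "(\<lambda>m. kern m z) \<longlonglongrightarrow> gauss z"
    unfolding kern_def by (rule pw) simp
  have gr: "(\<lambda>m. sqrt (real (m + 2)) *\<^sub>R cos_mean_grad (?z m)) \<longlonglongrightarrow> - z"
  proof (rule vec_tendstoI)
    fix i
    have "(\<lambda>m. - (1 / ?d) * (sqrt (real (m + 2)) * sin ((?d * z $ i) * (1 / sqrt (real (m + 2)))))) \<longlonglongrightarrow> - (1 / ?d) * (?d * z $ i)"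
      by (intro tendsto_mult_left tendsto_sin_scaled)
    thus "(\<lambda>m. (sqrt (real (m + 2)) *\<^sub>R cos_mean_grad (?z m)) $ i) \<longlonglongrightarrow> (- z) $ i"
      by (simp add: cos_mean_grad_def mult_ac)
  qed
  show "(\<lambda>m. kern_grad m z) \<longlonglongrightarrow> - gauss z *\<^sub>R z"
    using tendsto_scaleR[OF pw[of 1] gr] unfolding kern_grad_def by simp
  have hs: "(\<lambda>m. cos_mean_hess (?z m)) \<longlonglongrightarrow> - mat 1"
  proof (intro vec_tendstoI)
    fix i j
    have "(\<lambda>m::nat. - cos (y * (1 / sqrt (real (m + 2))))) \<longlonglongrightarrow> - 1" for y
    proof -
      have "(\<lambda>m::nat. 1 / sqrt (real (m + 2))) \<longlonglongrightarrow> 0" by real_asymp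
      hence "(\<lambda>m::nat. - cos (y * (1 / sqrt (real (m + 2))))) \<longlonglongrightarrow> - cos (y * 0)"
        by (intro tendsto_intros)
      thus ?thesis by simp
    qed
    from this[of "?d * z $ i"] show "(\<lambda>m. cos_mean_hess (?z m) $ i $ j) \<longlonglongrightarrow> (- mat 1) $ i $ j"
      by (cases "i = j") (simp_all add: cos_mean_hess_def mat_def mult_ac)
  qed
  have "(\<lambda>m. real (m + 1) / real (m + 2)) \<longlonglongrightarrow> 1" by real_asymp
  from tendsto_add[OF tendsto_scaleR[OF pw[of 1] hs]
      tendsto_scaleR[OF tendsto_mult[OF this pw[of 0]] tendsto_outer_product[OF gr gr]]]
  have "(\<lambda>m. kern_hess m z) \<longlonglongrightarrow> gauss z *\<^sub>R (- mat 1) + (1 * gauss z) *\<^sub>R outer_product (- z) (- z)"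
    unfolding kern_hess_def by simp
  also have "outer_product (- z) (- z) = outer_product z z" by (simp add: outer_product_def)
  finally show "(\<lambda>m. kern_hess m z) \<longlonglongrightarrow> gauss_hess z"
    by (simp add: gauss_hess_def algebra_simps)
qed

text \<open>The bounds are inherited from \<open>kern\<close> by passing to the limit. The Gaussian
  thereby gets the same constant as its approximants, as \<open>generator_identity_limit\<close>
  demands.\<close>

lemma C2_jet_gauss: "C2_jet (real CARD('n) + 3) (gauss :: real^'n \<Rightarrow> real) (\<lambda>z. - gauss z *\<^sub>R z) gauss_hess"
proof (rule C2_jetI)
  fix z :: "real^'n"
  note d = C2_jetD[OF C2_jet_kern]
  have dg: "(gauss has_derivative (\<lambda>h. - gauss z * (z \<bullet> h))) (at z)" for z :: "real^'n"
    unfolding gauss_def[abs_def] power2_norm_eq_inner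
    by (auto intro!: derivative_eq_intros simp: inner_commute algebra_simps)
  thus "(gauss has_derivative (\<lambda>h. (- gauss z *\<^sub>R z) \<bullet> h)) (at z)" by simp
  show "((\<lambda>z. - gauss z *\<^sub>R z) has_derivative (\<lambda>h. gauss_hess z *v h)) (at z)"
    by (auto intro!: derivative_eq_intros dg simp: gauss_hess_def outer_product_mult fun_eq_iff
        scaleR_matrix_vector_assoc[symmetric] matrix_vector_mult_diff_rdistrib algebra_simps)
  show "\<bar>gauss z\<bar> \<le> real CARD('n) + 3"
    by (rule LIMSEQ_le_const2[OF tendsto_rabs[OF kern_tendsto(1)]]) (use d(6) in blast)
  show "norm (- gauss z *\<^sub>R z) \<le> real CARD('n) + 3"
    by (rule LIMSEQ_le_const2[OF tendsto_norm[OF kern_tendsto(2)]]) (use d(7) in blast)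
  show "norm (gauss_hess z) \<le> real CARD('n) + 3"
    by (rule LIMSEQ_le_const2[OF tendsto_norm[OF kern_tendsto(3)]]) (use d(8) in blast)
next
  show "continuous_on UNIV (gauss_hess :: real^'n \<Rightarrow> _)"
    unfolding gauss_hess_def[abs_def] gauss_def by (intro continuous_intros) auto
qed

lemma C2_jet_scaled_arg:
  fixes f :: "real^'n \<Rightarrow> real"
  assumes "C2_jet C f g H"
  shows "C2_jet (C * (1 + \<bar>c\<bar>)\<^sup>2) (\<lambda>z. f (c *\<^sub>R z)) (\<lambda>z. c *\<^sub>R g (c *\<^sub>R z)) (\<lambda>z. c\<^sup>2 *\<^sub>R H (c *\<^sub>R z))"
proof (rule C2_jetI)
  fix z :: "real^'n"
  note d = C2_jetD[OF assms]
  have dc: "((\<lambda>z. c *\<^sub>R z) has_derivative (\<lambda>h. c *\<^sub>R h)) (at z)"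
    by (auto intro!: derivative_eq_intros)
  show "((\<lambda>z. f (c *\<^sub>R z)) has_derivative (\<lambda>h. (c *\<^sub>R g (c *\<^sub>R z)) \<bullet> h)) (at z)"
    using has_derivative_compose[OF dc d(1)] by simp
  show "((\<lambda>z. c *\<^sub>R g (c *\<^sub>R z)) has_derivative (\<lambda>h. (c\<^sup>2 *\<^sub>R H (c *\<^sub>R z)) *v h)) (at z)"
    using has_derivative_scaleR_right[OF has_derivative_compose[OF dc d(2)], of c]
    by (simp add: matrix_vector_mult_scaleR scaleR_matrix_vector_assoc[symmetric] power2_eq_square)
  have b: "1 \<le> (1 + \<bar>c\<bar>)\<^sup>2" "\<bar>c\<bar> \<le> (1 + \<bar>c\<bar>)\<^sup>2" "c\<^sup>2 \<le> (1 + \<bar>c\<bar>)\<^sup>2"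
    by (auto simp: power2_eq_square algebra_simps)
  show "\<bar>f (c *\<^sub>R z)\<bar> \<le> C * (1 + \<bar>c\<bar>)\<^sup>2"
    using mult_mono[OF d(6) b(1) d(9)] by simp
  show "norm (c *\<^sub>R g (c *\<^sub>R z)) \<le> C * (1 + \<bar>c\<bar>)\<^sup>2"
    using mult_mono[OF d(7) b(2) d(9)] by (simp add: mult.commute)
  show "norm (c\<^sup>2 *\<^sub>R H (c *\<^sub>R z)) \<le> C * (1 + \<bar>c\<bar>)\<^sup>2"
    using mult_mono[OF d(8)[of "c *\<^sub>R z"] b(3) d(9)] by (simp add: mult.commute)
next
  show "continuous_on UNIV (\<lambda>z. c\<^sup>2 *\<^sub>R H (c *\<^sub>R z))"
    by (intro continuous_intros continuous_on_compose2[OF C2_jetD(5)[OF assms] _ subset_UNIV])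
qed

lemma C2_jet_shift:
  assumes "C2_jet C f g H"
  shows "C2_jet C (\<lambda>x. f (x + y)) (\<lambda>x. g (x + y)) (\<lambda>x. H (x + y))"
proof (rule C2_jetI)
  fix x
  note d = C2_jetD[OF assms]
  have dc: "((\<lambda>x. x + y) has_derivative (\<lambda>h. h)) (at x)" by (auto intro!: derivative_eq_intros)
  show "((\<lambda>x. f (x + y)) has_derivative (\<lambda>h. g (x + y) \<bullet> h)) (at x)"
    "((\<lambda>x. g (x + y)) has_derivative (\<lambda>h. H (x + y) *v h)) (at x)"
    using has_derivative_compose[OF dc d(1)] has_derivative_compose[OF dc d(2)] by simp_all
qed (auto intro: C2_jetD[OF assms] intro!: continuous_intros continuous_on_compose2[OF C2_jetD(5)[OF assms] _ subset_UNIV])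

section \<open>Convolution with an integrable function and Gaussian integrals\<close>

lemma conv_measurable:
  fixes g :: "real^'n \<Rightarrow> 'b::{banach,second_countable_topology}" and f :: "real^'n \<Rightarrow> real"
  assumes "integrable lborel f" "continuous_on UNIV g"
  shows "(\<lambda>y. f y *\<^sub>R g (x - y)) \<in> borel_measurable lborel"
proof -
  have "(\<lambda>y. g (x - y)) \<in> borel_measurable borel"
    by (intro borel_measurable_continuous_onI continuous_on_compose2[OF assms(2) _ subset_UNIV] continuous_intros)
  thus ?thesis using borel_measurable_integrable[OF assms(1)] by measurable
qed

text \<open>All derivatives fall on the kernel; \<open>f\<close> contributes only its absolute value
  as an integrable weight.\<close>

lemma C2_jet_conv:
  fixes f :: "real^'n \<Rightarrow> real"
  assumes j: "C2_jet B k g H" and f: "integrable lborel f"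
  shows "C2_jet (\<integral>y. \<bar>f y\<bar> * B \<partial>lborel) (\<lambda>x. \<integral>y. f y * k (x - y) \<partial>lborel)
    (\<lambda>x. \<integral>y. f y *\<^sub>R g (x - y) \<partial>lborel) (\<lambda>x. \<integral>y. f y *\<^sub>R H (x - y) \<partial>lborel)"
proof (rule C2_jet_integral)
  show "C2_jet (\<bar>f y\<bar> * B) (\<lambda>x. f y * k (x - y)) (\<lambda>x. f y *\<^sub>R g (x - y)) (\<lambda>x. f y *\<^sub>R H (x - y))" for y
    using C2_jet_scale[OF C2_jet_shift[OF j, of "- y"]] by simp
  show "integrable lborel (\<lambda>y. \<bar>f y\<bar> * B)" using f by simp
  show "(\<lambda>y. f y * k (x - y)) \<in> borel_measurable lborel" for x
    using conv_measurable[OF f C2_jetD(3)[OF j]] by simp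
qed (rule conv_measurable[OF f C2_jetD(4)[OF j]] conv_measurable[OF f C2_jetD(5)[OF j]])+

lemma conv_tendsto:
  fixes g :: "nat \<Rightarrow> real^'n \<Rightarrow> 'b::{banach,second_countable_topology}" and f :: "real^'n \<Rightarrow> real"
  assumes "integrable lborel f" "\<And>m. continuous_on UNIV (g m)" "continuous_on UNIV g0"
    "\<And>m z. norm (g m z) \<le> B" "\<And>z. (\<lambda>m. g m z) \<longlonglongrightarrow> g0 z"
  shows "(\<lambda>m. \<integral>y. f y *\<^sub>R g m (x - y) \<partial>lborel) \<longlonglongrightarrow> (\<integral>y. f y *\<^sub>R g0 (x - y) \<partial>lborel)"
proof (rule integral_dominated_convergence[where w = "\<lambda>y. \<bar>f y\<bar> * B"])
  show "integrable lborel (\<lambda>y. \<bar>f y\<bar> * B)" using assms(1) by simp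
  show "AE y in lborel. (\<lambda>m. f y *\<^sub>R g m (x - y)) \<longlonglongrightarrow> f y *\<^sub>R g0 (x - y)"
    by (intro AE_I2 tendsto_intros assms)
  show "AE y in lborel. norm (f y *\<^sub>R g m (x - y)) \<le> \<bar>f y\<bar> * B" for m
    by (intro AE_I2) (auto intro!: mult_left_mono assms)
qed (intro conv_measurable assms)+

lemma integrable_gauss_scaled:
  assumes "c \<noteq> 0"
  shows "integrable lborel (\<lambda>x :: real^'n. gauss (c *\<^sub>R x))"
proof -
  \<comment> \<open>The factor in each coordinate is a multiple of the centred normal density with
    this standard deviation; the sign of \<open>c\<close> is irrelevant.\<close>
  define \<sigma> where "\<sigma> = 1 / \<bar>c\<bar>"
  have \<sigma>: "\<sigma> > 0" "\<sigma>\<^sup>2 = 1 / c\<^sup>2" using assms by (auto simp: \<sigma>_def power_divide)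
  have 1: "integrable lborel (\<lambda>x::real. exp (- (c * x)\<^sup>2 / 2))"
  proof -
    have "integrable lborel (\<lambda>x. normal_density 0 \<sigma> x)"
      using integrable_normal_moment[of 0 \<sigma> 0] \<sigma> by simp
    hence "integrable lborel (\<lambda>x. sqrt (2 * pi * \<sigma>\<^sup>2) * normal_density 0 \<sigma> x)" by simp
    also have "(\<lambda>x. sqrt (2 * pi * \<sigma>\<^sup>2) * normal_density 0 \<sigma> x) = (\<lambda>x. exp (- (c * x)\<^sup>2 / 2))"
      using \<sigma>(1) assms unfolding normal_density_def by (simp add: \<sigma>(2) fun_eq_iff power_mult_distrib)
    finally show ?thesis .
  qed
  interpret product_sigma_finite "\<lambda>_. lborel :: real measure" by standard
  have "integrable (\<Pi>\<^sub>M b\<in>Basis. lborel) (\<lambda>x. \<Prod>b\<in>(Basis :: (real^'n) set). exp (- (c * x b)\<^sup>2 / 2))"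
    by (rule product_integrable_prod) (use 1 in auto)
  also have "(\<lambda>x. \<Prod>b\<in>(Basis :: (real^'n) set). exp (- (c * x b)\<^sup>2 / 2)) =
      (\<lambda>x. gauss (c *\<^sub>R (\<Sum>b\<in>(Basis :: (real^'n) set). x b *\<^sub>R b)))"
  proof
    fix x :: "real^'n \<Rightarrow> real"
    let ?s = "\<Sum>b\<in>(Basis :: (real^'n) set). x b *\<^sub>R b"
    have "(norm (c *\<^sub>R ?s))\<^sup>2 = (\<Sum>b\<in>(Basis :: (real^'n) set). (c * x b)\<^sup>2)"
      unfolding power2_norm_eq_inner
      by (subst euclidean_inner) (simp add: power2_eq_square inner_sum_left inner_Basis if_distrib cong: if_cong)
    thus "(\<Prod>b\<in>(Basis :: (real^'n) set). exp (- (c * x b)\<^sup>2 / 2)) = gauss (c *\<^sub>R ?s)"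
      by (simp add: gauss_def exp_sum[symmetric] sum_divide_distrib sum_negf)
  qed
  finally have "integrable (distr (\<Pi>\<^sub>M b\<in>Basis. lborel) borel (\<lambda>f. \<Sum>b\<in>(Basis :: (real^'n) set). f b *\<^sub>R b)) (\<lambda>x. gauss (c *\<^sub>R x))"
    by (subst integrable_distr_eq) (auto simp: gauss_def)
  thus ?thesis by (subst lborel_eq)
qed

lemma gauss_pos: "0 < gauss z" by (simp add: gauss_def)

lemma gauss_le_1: "gauss z \<le> 1" by (simp add: gauss_def)

text \<open>Makes the division in \<open>gauss_weight\<close> meaningful: a vanishing integral would
  force the strictly positive \<open>gauss\<close> to be 0 almost everywhere.\<close>

lemma integral_gauss_pos: "0 < (\<integral>z. gauss (z :: real^'n) \<partial>lborel)"
proof -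
  have int: "integrable lborel (gauss :: real^'n \<Rightarrow> real)"
    using integrable_gauss_scaled[of 1] by simp
  have "(\<integral>z. gauss (z :: real^'n) \<partial>lborel) \<noteq> 0"
  proof
    assume "(\<integral>z. gauss (z :: real^'n) \<partial>lborel) = 0"
    hence "AE z in lborel. gauss (z :: real^'n) = 0"
      using integral_nonneg_eq_0_iff_AE[OF int AE_I2[OF less_imp_le[OF gauss_pos]]] by blast
    hence "AE z in (lborel :: (real^'n) measure). False"
      by (rule AE_mp) (intro AE_I2, simp add: gauss_def)
    thus False by (simp add: AE_iff_measurable[of UNIV])
  qed
  moreover have "0 \<le> (\<integral>z. gauss (z :: real^'n) \<partial>lborel)" by (simp add: gauss_def)
  ultimately show ?thesis by simp
qed

text \<open>Substitute \<open>y = x + \<sigma> *\<^sub>R z\<close>. The Jacobian cancels the power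
  of \<open>\<sigma>\<close> on the left, and the sign in \<open>x - y\<close> disappears because
  \<open>gauss\<close> is even.\<close>

lemma conv_gauss_substitution:
  fixes f :: "real^'n \<Rightarrow> real"
  assumes "f \<in> borel_measurable borel" "\<sigma> > 0"
  shows "(\<integral>y. (f y / \<sigma> ^ CARD('n)) * gauss ((1 / \<sigma>) *\<^sub>R (x - y)) \<partial>lborel) = (\<integral>z. f (x + \<sigma> *\<^sub>R z) * gauss z \<partial>lborel)"
proof -
  have [measurable]: "(gauss :: real^'n \<Rightarrow> real) \<in> borel_measurable borel"
    by (rule borel_measurable_continuous_onI[OF C2_jetD(3)[OF C2_jet_gauss]])
  have [measurable]: "f \<in> borel_measurable borel" by (rule assms)
  have "(\<integral>y. (f y / \<sigma> ^ CARD('n)) * gauss ((1 / \<sigma>) *\<^sub>R (x - y)) \<partial>lborel) =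
     (\<integral>y. (f y / \<sigma> ^ CARD('n)) * gauss ((1 / \<sigma>) *\<^sub>R (x - y)) \<partial>density (distr lborel borel (\<lambda>z. x + \<sigma> *\<^sub>R z)) (\<lambda>_. ennreal (\<sigma> ^ CARD('n))))"
    using assms(2) by (subst lborel_affine[of \<sigma> x]) simp_all
  also have "\<dots> = (\<integral>y. \<sigma> ^ CARD('n) *\<^sub>R ((f y / \<sigma> ^ CARD('n)) * gauss ((1 / \<sigma>) *\<^sub>R (x - y))) \<partial>distr lborel borel (\<lambda>z. x + \<sigma> *\<^sub>R z))"
    using assms(2) by (intro integral_density) auto
  also have "\<dots> = (\<integral>z. \<sigma> ^ CARD('n) *\<^sub>R ((f (x + \<sigma> *\<^sub>R z) / \<sigma> ^ CARD('n)) * gauss ((1 / \<sigma>) *\<^sub>R (x - (x + \<sigma> *\<^sub>R z)))) \<partial>lborel)"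
    by (rule integral_distr) measurable
  also have "\<dots> = (\<integral>z. f (x + \<sigma> *\<^sub>R z) * gauss z \<partial>lborel)"
    using assms(2) by (intro Bochner_Integration.integral_cong) (auto simp: gauss_def)
  finally show ?thesis .
qed

section \<open>From trigonometric functions to all jets\<close>

text \<open>Complex coefficients make the class closed under products, as frequencies add; real
  parts are taken only at the end. Its purpose is to recognize \<open>kern\<close> as a finite sum
  of waves.\<close>

inductive trigpoly :: "(real^'n \<Rightarrow> complex) \<Rightarrow> bool" where
  monomial: "trigpoly (\<lambda>z. w * iexp (u \<bullet> z))"
| add: "trigpoly p \<Longrightarrow> trigpoly q \<Longrightarrow> trigpoly (\<lambda>z. p z + q z)"

lemma trigpoly_const: "trigpoly (\<lambda>z. w)"
  using trigpoly.monomial[of w 0] by simp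

lemma trigpoly_monomial_mult:
  assumes "trigpoly q" shows "trigpoly (\<lambda>z. w * iexp (u \<bullet> z) * q z)"
  using assms
proof induction
  case (monomial w' u')
  have "w * iexp (u \<bullet> z) * (w' * iexp (u' \<bullet> z)) = (w * w') * iexp ((u + u') \<bullet> z)" for z
    by (simp add: inner_add_left distrib_left exp_add)
  thus ?case by (simp only: trigpoly.monomial)
next
  case (add p q) thus ?case by (simp only: distrib_left trigpoly.add)
qed

lemma trigpoly_mult:
  assumes "trigpoly p" "trigpoly q" shows "trigpoly (\<lambda>z. p z * q z)"
  using assms(1)
proof induction
  case (monomial w u) thus ?case by (rule trigpoly_monomial_mult[OF assms(2)])
next
  case (add p q) thus ?case by (simp only: distrib_right trigpoly.add)
qed

lemma trigpoly_power: "trigpoly p \<Longrightarrow> trigpoly (\<lambda>z. p z ^ k)"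
  by (induction k) (auto intro: trigpoly_const trigpoly_mult)

lemma trigpoly_sum: "finite I \<Longrightarrow> (\<And>i. i \<in> I \<Longrightarrow> trigpoly (p i)) \<Longrightarrow> trigpoly (\<lambda>z. \<Sum>i\<in>I. p i z)"
  by (induction I rule: finite_induct) (auto intro: trigpoly_const trigpoly.add)

lemma trigpoly_cos: "trigpoly (\<lambda>z. complex_of_real (cos (b * z $ i)))"
proof -
  have "complex_of_real (cos (b * z $ i)) = 1/2 * iexp (axis i b \<bullet> z) + 1/2 * iexp (axis i (- b) \<bullet> z)" for z :: "real^'a"
    by (simp add: cos_of_real[symmetric] cos_exp_eq inner_axis' field_simps)
  thus ?thesis by (simp only: trigpoly.intros)
qed

lemma trigpoly_kern: "trigpoly (\<lambda>z. complex_of_real (kern m (c *\<^sub>R z)))"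
proof -
  have "trigpoly (\<lambda>z :: real^'n. ((1 / of_nat CARD('n)) * (\<Sum>i\<in>UNIV. complex_of_real (cos ((sqrt (CARD('n)) * (1 / sqrt (real (m + 2)) * c)) * z $ i)))) ^ (m + 2))"
    by (intro trigpoly_power trigpoly_mult trigpoly_const trigpoly_sum trigpoly_cos) simp
  thus ?thesis by (simp add: kern_def cos_mean_def mult_ac)
qed

lemma trigpoly_bounded_continuous:
  assumes "trigpoly p" shows "continuous_on UNIV p \<and> (\<exists>B. \<forall>z. cmod (p z) \<le> B)"
  using assms
proof induction
  case (monomial w u)
  have "continuous_on UNIV (\<lambda>z. w * iexp (u \<bullet> z))" by (intro continuous_intros)
  moreover have "\<forall>z. cmod (w * iexp (u \<bullet> z)) \<le> cmod w" by (simp add: norm_mult)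
  ultimately show ?case by blast
next
  case (add p q)
  then obtain B B' where "\<And>z. cmod (p z) \<le> B" "\<And>z. cmod (q z) \<le> B'" by blast
  hence "\<forall>z. cmod (p z + q z) \<le> B + B'" by (blast intro: norm_triangle_mono)
  thus ?case using add by (blast intro: continuous_intros)
qed

section \<open>Gaussian mollification and cut-off\<close>

definition gauss_weight :: "real^'n \<Rightarrow> real" where
  "gauss_weight z = gauss z / (\<integral>z. gauss (z :: real^'n) \<partial>lborel)"

text \<open>The translate stands on \<open>g\<close> rather than on the weight, so that
  differentiation acts on \<open>g\<close> and mollifying a jet means mollifying its three entries.
  The value type is general for that reason.\<close>

definition mollify :: "real \<Rightarrow> (real^'n \<Rightarrow> 'b) \<Rightarrow> real^'n \<Rightarrow> 'b::{banach,second_countable_topology}" where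
  "mollify \<sigma> g x = (\<integral>z. gauss_weight z *\<^sub>R g (x + \<sigma> *\<^sub>R z) \<partial>lborel)"

lemma integrable_gauss_weight: "integrable lborel (gauss_weight :: real^'n \<Rightarrow> real)"
  using integrable_gauss_scaled[of 1, where 'n = 'n] by (simp add: gauss_weight_def[abs_def])

lemma integral_gauss_weight: "(\<integral>z. gauss_weight (z :: real^'n) \<partial>lborel) = 1"
  using integral_gauss_pos[where 'n = 'n] by (simp add: gauss_weight_def)

lemma gauss_weight_nonneg: "0 \<le> gauss_weight (z :: real^'n)"
  using gauss_pos[of z] integral_gauss_pos[where 'n = 'n] by (simp add: gauss_weight_def)

lemma mollify_measurable:
  fixes g :: "real^'n \<Rightarrow> 'b::{banach,second_countable_topology}"
  assumes "continuous_on UNIV g"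
  shows "(\<lambda>z. gauss_weight z *\<^sub>R g (x + \<sigma> *\<^sub>R z)) \<in> borel_measurable lborel"
proof -
  have "(\<lambda>z. g (x + \<sigma> *\<^sub>R z)) \<in> borel_measurable borel"
    by (intro borel_measurable_continuous_onI continuous_on_compose2[OF assms _ subset_UNIV] continuous_intros)
  thus ?thesis using borel_measurable_integrable[OF integrable_gauss_weight] by measurable
qed

text \<open>The weight has mass 1, so the constant stays \<open>C\<close> for every
  \<open>\<sigma>\<close>; \<open>generator_identity_limit\<close> relies on this.\<close>

lemma C2_jet_mollify:
  fixes f :: "real^'n \<Rightarrow> real"
  assumes j: "C2_jet C f g H"
  shows "C2_jet C (mollify \<sigma> f) (mollify \<sigma> g) (mollify \<sigma> H)"
proof -
  have "C2_jet (\<integral>z. \<bar>gauss_weight (z :: real^'n)\<bar> * C \<partial>lborel) (\<lambda>x. \<integral>z. gauss_weight z * f (x + \<sigma> *\<^sub>R z) \<partial>lborel)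
     (\<lambda>x. \<integral>z. gauss_weight z *\<^sub>R g (x + \<sigma> *\<^sub>R z) \<partial>lborel) (\<lambda>x. \<integral>z. gauss_weight z *\<^sub>R H (x + \<sigma> *\<^sub>R z) \<partial>lborel)"
  proof (rule C2_jet_integral)
    show "C2_jet (\<bar>gauss_weight z\<bar> * C) (\<lambda>x. gauss_weight z * f (x + \<sigma> *\<^sub>R z)) (\<lambda>x. gauss_weight z *\<^sub>R g (x + \<sigma> *\<^sub>R z)) (\<lambda>x. gauss_weight z *\<^sub>R H (x + \<sigma> *\<^sub>R z))" for z
      by (rule C2_jet_scale[OF C2_jet_shift[OF j]])
    show "integrable lborel (\<lambda>z. \<bar>gauss_weight (z :: real^'n)\<bar> * C)"
      by (intro integrable_mult_left integrable_abs integrable_gauss_weight)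
    show "(\<lambda>z. gauss_weight z * f (x + \<sigma> *\<^sub>R z)) \<in> borel_measurable lborel" for x
      using mollify_measurable[OF C2_jetD(3)[OF j]] by simp
  qed (rule mollify_measurable[OF C2_jetD(4)[OF j]] mollify_measurable[OF C2_jetD(5)[OF j]])+
  moreover have "(\<integral>z. \<bar>gauss_weight (z :: real^'n)\<bar> * C \<partial>lborel) = C"
    unfolding abs_of_nonneg[OF gauss_weight_nonneg] by (simp add: integral_gauss_weight)
  ultimately show ?thesis unfolding mollify_def[abs_def] by (simp only: real_scaleR_def)
qed

lemma mollify_tendsto:
  fixes g :: "real^'n \<Rightarrow> 'b::{banach,second_countable_topology}"
  assumes g: "continuous_on UNIV g" "\<And>x. norm (g x) \<le> C" and s: "s \<longlonglongrightarrow> 0"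
  shows "(\<lambda>i. mollify (s i) g x) \<longlonglongrightarrow> g x"
proof -
  have "(\<lambda>i. mollify (s i) g x) \<longlonglongrightarrow> (\<integral>z. gauss_weight z *\<^sub>R g (x + 0 *\<^sub>R z) \<partial>lborel)"
    unfolding mollify_def
  proof (rule integral_dominated_convergence[where w = "\<lambda>z. gauss_weight z * C"])
    show "AE z in lborel. (\<lambda>i. gauss_weight z *\<^sub>R g (x + s i *\<^sub>R z)) \<longlonglongrightarrow> gauss_weight z *\<^sub>R g (x + 0 *\<^sub>R z)"
      by (intro AE_I2 tendsto_scaleR tendsto_const continuous_on_tendsto_compose[OF g(1)] tendsto_add s) auto
    show "AE z in lborel. norm (gauss_weight z *\<^sub>R g (x + s i *\<^sub>R z)) \<le> gauss_weight z * C" for i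
      unfolding norm_scaleR real_norm_def abs_of_nonneg[OF gauss_weight_nonneg]
      by (intro AE_I2 mult_left_mono g gauss_weight_nonneg)
  qed (intro mollify_measurable g integrable_mult_left integrable_gauss_weight)+
  also have "(\<integral>z. gauss_weight z *\<^sub>R g (x + 0 *\<^sub>R z) \<partial>lborel) = (\<integral>z. gauss_weight (z :: real^'n) \<partial>lborel) *\<^sub>R g x"
    by (simp only: scaleR_zero_left add_0_right, rule integral_scaleR_left, rule integrable_gauss_weight)
  also have "\<dots> = g x" by (simp add: integral_gauss_weight)
  finally show ?thesis .
qed

lemma integrable_mult_gauss_scaled:
  fixes h :: "real^'n \<Rightarrow> real"
  assumes "continuous_on UNIV h" "\<And>x. \<bar>h x\<bar> \<le> C" "c \<noteq> 0"
  shows "integrable lborel (\<lambda>x :: real^'n. h x * gauss (c *\<^sub>R x))"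
proof (rule Bochner_Integration.integrable_bound)
  show "integrable lborel (\<lambda>x :: real^'n. C * gauss (c *\<^sub>R x))"
    by (intro integrable_mult_right integrable_gauss_scaled assms)
  show "(\<lambda>x. h x * gauss (c *\<^sub>R x)) \<in> borel_measurable lborel"
    using borel_measurable_continuous_onI[OF assms(1)] borel_measurable_integrable[OF integrable_gauss_scaled[OF assms(3)]]
    by measurable
  show "AE x in lborel. norm (h x * gauss (c *\<^sub>R x)) \<le> norm (C * gauss (c *\<^sub>R x))"
    using order_trans[OF assms(2) abs_ge_self] by (intro AE_I2) (auto simp: abs_mult intro!: mult_right_mono)
qed

context OU_data
begin

text \<open>Convolving with a wave gives a wave of the same frequency, whose amplitude is multiplied
  by a Fourier coefficient of \<open>f\<close>; sums follow by linearity.\<close>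

lemma generator_identity_conv_trigpoly:
  assumes p: "trigpoly p" and f: "integrable lborel f"
  shows "generator_identity (\<lambda>x. \<integral>y. f y * Re (p (x - y)) \<partial>lborel)"
  using p
proof induction
  case (monomial w u)
  \<comment> \<open>The Fourier transform of \<open>f\<close> at frequency \<open>u\<close>.\<close>
  define W where "W = (\<integral>y. complex_of_real (f y) * iexp (- (u \<bullet> y)) \<partial>lborel)"
  have int: "integrable lborel (\<lambda>y. complex_of_real (f y) * iexp (- (u \<bullet> y)))"
    by (rule Bochner_Integration.integrable_bound[OF f])
       (use borel_measurable_integrable[OF f] in \<open>auto simp: norm_mult\<close>)
  have "(\<integral>y. f y * Re (w * iexp (u \<bullet> (x - y))) \<partial>lborel) = Re ((w * W) * iexp (u \<bullet> x))" for x
  proof -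
    have "f y * Re (w * iexp (u \<bullet> (x - y))) = Re ((w * iexp (u \<bullet> x)) * (complex_of_real (f y) * iexp (- (u \<bullet> y))))" for y
    proof -
      have "iexp (u \<bullet> (x - y)) = iexp (u \<bullet> x) * iexp (- (u \<bullet> y))"
        by (simp add: inner_diff_right right_diff_distrib exp_add[symmetric])
      hence "(w * iexp (u \<bullet> x)) * (complex_of_real (f y) * iexp (- (u \<bullet> y))) = complex_of_real (f y) * (w * iexp (u \<bullet> (x - y)))"
        by (simp only: mult_ac)
      moreover have "Re (complex_of_real r * z) = r * Re z" for r z by simp
      ultimately show ?thesis by (simp only:)
    qed
    hence "(\<integral>y. f y * Re (w * iexp (u \<bullet> (x - y))) \<partial>lborel) =
        (\<integral>y. Re ((w * iexp (u \<bullet> x)) * (complex_of_real (f y) * iexp (- (u \<bullet> y)))) \<partial>lborel)"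
      by (simp only:)
    also have "\<dots> = Re (w * iexp (u \<bullet> x) * W)"
      unfolding W_def by (subst integral_Re) (intro integrable_mult_right int, simp only: integral_mult_right_zero)
    finally show ?thesis by (simp only: mult_ac)
  qed
  thus ?case by (simp only: generator_identity_trig)
next
  case (add p q)
  have int: "integrable lborel (\<lambda>y. f y * Re (p (x - y)))" if tp: "trigpoly p" for p and x :: "real^'n"
  proof -
    obtain B where "continuous_on UNIV p" and B: "\<And>z. cmod (p z) \<le> B"
      using trigpoly_bounded_continuous[OF tp] by blast
    hence c: "continuous_on UNIV (\<lambda>z. Re (p z))" by (intro continuous_intros)
    show ?thesis
    proof (rule Bochner_Integration.integrable_bound[OF integrable_mult_left[OF f, of B]])
      show "(\<lambda>y. f y * Re (p (x - y))) \<in> borel_measurable lborel"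
        using conv_measurable[OF f c] by simp
      show "AE y in lborel. norm (f y * Re (p (x - y))) \<le> norm (f y * B)"
        using order_trans[OF order_trans[OF abs_Re_le_cmod B] abs_ge_self]
        by (intro AE_I2) (auto simp: abs_mult intro!: mult_left_mono)
    qed
  qed
  have "(\<integral>y. f y * Re (p (x - y) + q (x - y)) \<partial>lborel) =
      (\<integral>y. f y * Re (p (x - y)) \<partial>lborel) + (\<integral>y. f y * Re (q (x - y)) \<partial>lborel)" for x
    using int[OF add.hyps(1), of x] int[OF add.hyps(2), of x] by (simp add: distrib_left)
  thus ?case using generator_identity_add[OF add.IH] by simp
qed

text \<open>Convolution with the fixed integrable \<open>f\<close> turns bounded pointwise
  convergence of the kernels and their derivatives into pointwise convergence of jets with one
  constant.\<close>

lemma generator_identity_conv_gauss: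
  assumes f: "integrable lborel f"
  shows "generator_identity (\<lambda>x. \<integral>y. f y * gauss (c *\<^sub>R (x - y)) \<partial>lborel)"
proof -
  note k = C2_jet_scaled_arg[OF C2_jet_kern, of c] and g = C2_jet_scaled_arg[OF C2_jet_gauss, of c]
  note dk = C2_jetD[OF k] and dg = C2_jetD[OF g]
  show ?thesis
  proof (rule generator_identity_limit[OF _ C2_jet_conv[OF k f] C2_jet_conv[OF g f]])
    fix m
    show "generator_identity (\<lambda>x. \<integral>y. f y * kern m (c *\<^sub>R (x - y)) \<partial>lborel)"
      using generator_identity_conv_trigpoly[OF trigpoly_kern[of m c] f] by simp
  next
    fix x
    show "(\<lambda>m. \<integral>y. f y * kern m (c *\<^sub>R (x - y)) \<partial>lborel) \<longlonglongrightarrow> (\<integral>y. f y * gauss (c *\<^sub>R (x - y)) \<partial>lborel)"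
      using conv_tendsto[OF f dk(3) dg(3) dk(6)[folded real_norm_def] kern_tendsto(1), where x = x] by simp
    show "(\<lambda>m. \<integral>y. f y *\<^sub>R c *\<^sub>R kern_grad m (c *\<^sub>R (x - y)) \<partial>lborel) \<longlonglongrightarrow>
        (\<integral>y. f y *\<^sub>R c *\<^sub>R (- gauss (c *\<^sub>R (x - y)) *\<^sub>R c *\<^sub>R (x - y)) \<partial>lborel)"
      by (rule conv_tendsto[OF f dk(4) dg(4) dk(7)]) (intro tendsto_intros kern_tendsto)
    show "(\<lambda>m. \<integral>y. f y *\<^sub>R c\<^sup>2 *\<^sub>R kern_hess m (c *\<^sub>R (x - y)) \<partial>lborel) \<longlonglongrightarrow>
        (\<integral>y. f y *\<^sub>R c\<^sup>2 *\<^sub>R gauss_hess (c *\<^sub>R (x - y)) \<partial>lborel)"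
      by (rule conv_tendsto[OF f dk(5) dg(5) dk(8)]) (intro tendsto_intros kern_tendsto)
  qed
qed

text \<open>A mollification is a Gaussian convolution of \<open>f\<close> suitably rescaled. Read
  this way all derivatives fall on the Gaussian, so the lemma serves both jets and, for continuity
  in time, functions that are merely continuous and integrable.\<close>

lemma generator_identity_mollify:
  assumes f: "integrable lborel f" "continuous_on UNIV f" and \<sigma>: "\<sigma> > 0"
  shows "generator_identity (mollify \<sigma> f)"
proof -
  let ?\<kappa> = "\<integral>z. gauss (z :: real^'n) \<partial>lborel"
  have "generator_identity (\<lambda>x. \<integral>y. (f y / ?\<kappa> / \<sigma> ^ CARD('n)) * gauss ((1 / \<sigma>) *\<^sub>R (x - y)) \<partial>lborel)"
    by (rule generator_identity_conv_gauss) (use f in simp)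
  also have "(\<lambda>x. \<integral>y. (f y / ?\<kappa> / \<sigma> ^ CARD('n)) * gauss ((1 / \<sigma>) *\<^sub>R (x - y)) \<partial>lborel) = mollify \<sigma> f"
  proof
    fix x
    have "(\<lambda>y. f y / ?\<kappa>) \<in> borel_measurable borel"
      using borel_measurable_continuous_onI[OF f(2)] by measurable
    thus "(\<integral>y. (f y / ?\<kappa> / \<sigma> ^ CARD('n)) * gauss ((1 / \<sigma>) *\<^sub>R (x - y)) \<partial>lborel) = mollify \<sigma> f x"
      unfolding mollify_def gauss_weight_def by (subst conv_gauss_substitution[OF _ \<sigma>]) (simp_all add: mult_ac)
  qed
  finally show ?thesis .
qed

lemma generator_identity_C2_jet_integrable:
  assumes j: "C2_jet C f g H" and f: "integrable lborel f"
  shows "generator_identity f"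
proof -
  have s: "(\<lambda>i. 1 / real (Suc i)) \<longlonglongrightarrow> 0" by real_asymp
  show ?thesis
  proof (rule generator_identity_limit[OF _ C2_jet_mollify[OF j] j])
    show "generator_identity (mollify (1 / real (Suc i)) f)" for i
      by (rule generator_identity_mollify[OF f C2_jetD(3)[OF j]]) simp
  qed (rule mollify_tendsto[OF _ _ s], rule C2_jetD[OF j], (rule C2_jetD[OF j, unfolded real_norm_def[symmetric]])?)+
qed

text \<open>Multiplication by ever wider Gaussians makes \<open>f\<close> integrable; the
  derivatives of the cut-off carry factors \<open>c i\<close> and \<open>(c i)\<^sup>2\<close> and
  vanish in the limit.\<close>

lemma generator_identity_C2_jet:
  assumes j: "C2_jet C f g H"
  shows "generator_identity f"
proof -
  define c where "c i = 1 / real (Suc i)" for i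
  have c: "c \<longlonglongrightarrow> 0" "c i \<noteq> 0" "\<bar>c i\<bar> \<le> 1" for i
    unfolding c_def by real_asymp auto
  \<comment> \<open>The Gaussian jet constant times 4, the bound of
    \<open>(1 + \<bar>c i\<bar>)\<^sup>2\<close> for scales at most 1.\<close>
  let ?B = "(real CARD('n) + 3) * 4"
  have gj: "C2_jet ?B (\<lambda>z :: real^'n. gauss (c i *\<^sub>R z)) (\<lambda>z. c i *\<^sub>R (- gauss (c i *\<^sub>R z) *\<^sub>R (c i *\<^sub>R z)))
      (\<lambda>z. (c i)\<^sup>2 *\<^sub>R gauss_hess (c i *\<^sub>R z))" for i
  proof (rule C2_jet_mono[OF C2_jet_scaled_arg[OF C2_jet_gauss]])
    have "(1 + \<bar>c i\<bar>)\<^sup>2 \<le> 2\<^sup>2" using c(3)[of i] by (intro power_mono) auto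
    thus "(real CARD('n) + 3) * (1 + \<bar>c i\<bar>)\<^sup>2 \<le> ?B" by (intro mult_left_mono) auto
  qed
  note pj = C2_jet_mult[OF j gj]
  \<comment> \<open>Enlarges the constant of the limit \<open>f\<close> to the one shared by the
    products.\<close>
  have "4 * C * ?B \<ge> C" using C2_jetD(9)[OF j] by (simp add: algebra_simps)
  note j' = C2_jet_mono[OF j this]
  have lim: "(\<lambda>i. gauss (c i *\<^sub>R z)) \<longlonglongrightarrow> 1" "(\<lambda>i. c i *\<^sub>R (- gauss (c i *\<^sub>R z) *\<^sub>R (c i *\<^sub>R z))) \<longlonglongrightarrow> 0"
    "(\<lambda>i. (c i)\<^sup>2 *\<^sub>R gauss_hess (c i *\<^sub>R z)) \<longlonglongrightarrow> 0" for z :: "real^'n"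
  proof -
    have 0: "(\<lambda>i. c i *\<^sub>R z) \<longlonglongrightarrow> 0" using tendsto_scaleR[OF c(1) tendsto_const[of z]] by simp
    have 1: "(\<lambda>i. gauss (c i *\<^sub>R z)) \<longlonglongrightarrow> gauss (0 :: real^'n)"
      by (rule continuous_on_tendsto_compose[OF C2_jetD(3)[OF C2_jet_gauss] 0]) auto
    thus "(\<lambda>i. gauss (c i *\<^sub>R z)) \<longlonglongrightarrow> 1" by (simp add: gauss_def)
    show "(\<lambda>i. c i *\<^sub>R (- gauss (c i *\<^sub>R z) *\<^sub>R (c i *\<^sub>R z))) \<longlonglongrightarrow> 0"
      using tendsto_scaleR[OF c(1) tendsto_scaleR[OF tendsto_minus[OF 1] 0]] by simp
    have "(\<lambda>i. gauss_hess (c i *\<^sub>R z)) \<longlonglongrightarrow> gauss_hess (0 :: real^'n)"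
      by (rule continuous_on_tendsto_compose[OF C2_jetD(5)[OF C2_jet_gauss] 0]) auto
    from tendsto_scaleR[OF tendsto_power[OF c(1), of 2] this]
    show "(\<lambda>i. (c i)\<^sup>2 *\<^sub>R gauss_hess (c i *\<^sub>R z)) \<longlonglongrightarrow> 0" by simp
  qed
  show ?thesis
  proof (rule generator_identity_limit[OF _ pj j'])
    show "generator_identity (\<lambda>x. f x * gauss (c i *\<^sub>R x))" for i
      by (rule generator_identity_C2_jet_integrable[OF pj integrable_mult_gauss_scaled[OF C2_jetD(3,6)[OF j] c(2)]])
    fix y
    show "(\<lambda>i. f y * gauss (c i *\<^sub>R y)) \<longlonglongrightarrow> f y"
      using tendsto_mult_left[OF lim(1)[of y], of "f y"] by simp
    show "(\<lambda>i. f y *\<^sub>R c i *\<^sub>R (- gauss (c i *\<^sub>R y) *\<^sub>R c i *\<^sub>R y) + gauss (c i *\<^sub>R y) *\<^sub>R g y) \<longlonglongrightarrow> g y"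
      using tendsto_add[OF tendsto_scaleR[OF tendsto_const[of "f y"] lim(2)[of y]] tendsto_scaleR[OF lim(1)[of y] tendsto_const[of "g y"]]] by simp
    have z: "outer_product v 0 = 0" "outer_product 0 v = 0" for v :: "real^'n"
      by (simp_all add: outer_product_def vec_eq_iff)
    show "(\<lambda>i. f y *\<^sub>R (c i)\<^sup>2 *\<^sub>R gauss_hess (c i *\<^sub>R y) + gauss (c i *\<^sub>R y) *\<^sub>R H y +
        outer_product (g y) (c i *\<^sub>R (- gauss (c i *\<^sub>R y) *\<^sub>R c i *\<^sub>R y)) +
        outer_product (c i *\<^sub>R (- gauss (c i *\<^sub>R y) *\<^sub>R c i *\<^sub>R y)) (g y)) \<longlonglongrightarrow> H y"
      using tendsto_add[OF tendsto_add[OF tendsto_add[OF tendsto_scaleR[OF tendsto_const[of "f y"] lim(3)[of y]]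
         tendsto_scaleR[OF lim(1)[of y] tendsto_const[of "H y"]]] tendsto_outer_product[OF tendsto_const[of "g y"] lim(2)[of y]]]
         tendsto_outer_product[OF lim(2)[of y] tendsto_const[of "g y"]]] by (simp only: z) simp
  qed
qed

end

section \<open>Continuity in time\<close>

lemma uniformly_continuous_vanishing_at_infinity:
  fixes h :: "'a::euclidean_space \<Rightarrow> 'b::real_normed_vector"
  assumes c: "continuous_on UNIV h" and v: "\<And>e. e > 0 \<Longrightarrow> \<exists>R. \<forall>x. R \<le> norm x \<longrightarrow> norm (h x) < e"
  shows "uniformly_continuous_on UNIV h"
  unfolding uniformly_continuous_on_def
proof (intro allI impI)
  fix e :: real assume e: "e > 0"
  obtain R where R: "\<And>x. R \<le> norm x \<Longrightarrow> norm (h x) < e / 2" using v[of "e / 2"] e by auto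
  \<comment> \<open>The margin 1 ensures that two points at distance below 1 either both lie in this
    ball or both have norm at least \<open>R\<close>.\<close>
  have "uniformly_continuous_on (cball 0 (R + 1)) h"
    by (rule compact_uniformly_continuous[OF continuous_on_subset[OF c]]) auto
  then obtain d where d: "d > 0" "\<And>x y. x \<in> cball 0 (R + 1) \<Longrightarrow> y \<in> cball 0 (R + 1) \<Longrightarrow> dist y x < d \<Longrightarrow> dist (h y) (h x) < e"
    using e unfolding uniformly_continuous_on_def by meson
  have "dist (h y) (h x) < e" if xy: "dist y x < min d 1" for x y
  proof (cases "norm x \<le> R + 1 \<and> norm y \<le> R + 1")
    case True thus ?thesis using d(2)[of x y] xy by (simp add: dist_norm)
  next
    case False
    have "norm x \<le> norm y + dist y x" "norm y \<le> norm x + dist y x"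
      using norm_triangle_sub[of x y] norm_triangle_sub[of y x] by (auto simp: dist_norm norm_minus_commute)
    hence "R \<le> norm x" "R \<le> norm y" using False xy by auto
    hence "norm (h x) < e / 2" "norm (h y) < e / 2" using R by auto
    thus ?thesis unfolding dist_norm using norm_triangle_ineq4[of "h y" "h x"] by linarith
  qed
  thus "\<exists>d>0. \<forall>x\<in>UNIV. \<forall>x'\<in>UNIV. dist x' x < d \<longrightarrow> dist (h x') (h x) < e"
    using d(1) by (intro exI[of _ "min d 1"]) auto
qed

lemma mult_gauss_uniformly_continuous:
  fixes h :: "real^'n \<Rightarrow> real"
  assumes h: "continuous_on UNIV h" "\<And>x. \<bar>h x\<bar> \<le> C" and c: "c \<noteq> 0"
  shows "uniformly_continuous_on UNIV (\<lambda>x. h x * gauss (c *\<^sub>R x))"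
proof (rule uniformly_continuous_vanishing_at_infinity)
  show "continuous_on UNIV (\<lambda>x. h x * gauss (c *\<^sub>R x))"
    unfolding gauss_def by (intro continuous_intros h) auto
  fix e :: real assume e: "e > 0"
  have "((\<lambda>r. (\<bar>C\<bar> + 1) * exp (- (c\<^sup>2 * r\<^sup>2 / 2))) \<longlongrightarrow> 0) at_top"
  proof -
    have "c\<^sup>2 > 0" using c by simp
    thus ?thesis by real_asymp
  qed
  from order_tendstoD(2)[OF this e]
  obtain R where R: "\<And>r. R \<le> r \<Longrightarrow> (\<bar>C\<bar> + 1) * exp (- (c\<^sup>2 * r\<^sup>2 / 2)) < e"
    unfolding eventually_at_top_linorder by blast
  show "\<exists>R. \<forall>x. R \<le> norm x \<longrightarrow> norm (h x * gauss (c *\<^sub>R x)) < e"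
  proof (intro exI allI impI)
    fix x :: "real^'n" assume "R \<le> norm x"
    have "\<bar>h x\<bar> \<le> \<bar>C\<bar> + 1" using h(2)[of x] by linarith
    hence "norm (h x * gauss (c *\<^sub>R x)) \<le> (\<bar>C\<bar> + 1) * gauss (c *\<^sub>R x)"
      using gauss_pos[of "c *\<^sub>R x"] by (simp add: abs_mult)
    also have "\<dots> = (\<bar>C\<bar> + 1) * exp (- (c\<^sup>2 * (norm x)\<^sup>2 / 2))"
      by (simp add: gauss_def power_mult_distrib)
    also have "\<dots> < e" by (rule R) fact
    finally show "norm (h x * gauss (c *\<^sub>R x)) < e" .
  qed
qed

text \<open>Uniformity comes from dominated convergence along an arbitrary moving sequence of base
  points, where uniform continuity makes the integrand vanish; the points are chosen as
  counterexamples.\<close>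

lemma mollify_uniform_limit:
  fixes h :: "real^'n \<Rightarrow> real"
  assumes u: "uniformly_continuous_on UNIV h" and b: "\<And>x. \<bar>h x\<bar> \<le> C" and s: "s \<longlonglongrightarrow> 0"
  shows "uniform_limit UNIV (\<lambda>i. mollify (s i) h) h sequentially"
proof (rule uniform_limitI)
  fix e :: real assume e: "e > 0"
  have c: "continuous_on UNIV h" by (rule uniformly_continuous_imp_continuous[OF u])
  \<comment> \<open>A point where the error is at least \<open>e\<close>, if there is one; otherwise
    the choice is arbitrary and harmless.\<close>
  define X where "X i = (SOME x. e \<le> dist (mollify (s i) h x) (h x))" for i
  have int: "integrable lborel (\<lambda>z. gauss_weight z * h (x + r *\<^sub>R z))" for x r
  proof (rule Bochner_Integration.integrable_bound[OF integrable_mult_left[OF integrable_gauss_weight, of C]])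
    show "(\<lambda>z. gauss_weight z * h (x + r *\<^sub>R z)) \<in> borel_measurable lborel"
      using mollify_measurable[OF c] by simp
    show "AE z in lborel. norm (gauss_weight z * h (x + r *\<^sub>R z)) \<le> norm (gauss_weight z * C)"
      using order_trans[OF b abs_ge_self] by (intro AE_I2) (auto simp: abs_mult intro!: mult_left_mono)
  qed
  have eq: "mollify (s i) h x - h x = (\<integral>z. gauss_weight z * (h (x + s i *\<^sub>R z) - h x) \<partial>lborel)" for i x
  proof -
    have "(\<integral>z. gauss_weight z * (h (x + s i *\<^sub>R z) - h x) \<partial>lborel) =
        (\<integral>z. gauss_weight z * h (x + s i *\<^sub>R z) \<partial>lborel) - (\<integral>z. gauss_weight (z :: real^'n) * h x \<partial>lborel)"
      unfolding right_diff_distrib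
      by (intro Bochner_Integration.integral_diff int integrable_mult_left integrable_gauss_weight)
    thus ?thesis by (simp add: mollify_def integral_gauss_weight)
  qed
  have "(\<lambda>i. \<integral>z. gauss_weight z * (h (X i + s i *\<^sub>R z) - h (X i)) \<partial>lborel) \<longlonglongrightarrow> (\<integral>z. 0 \<partial>(lborel :: (real^'n) measure))"
  proof (rule integral_dominated_convergence)
    show "integrable lborel (\<lambda>z :: real^'n. gauss_weight z * (2 * C))"
      by (intro integrable_mult_left integrable_gauss_weight)
    show "AE z in lborel. (\<lambda>i. gauss_weight z * (h (X i + s i *\<^sub>R z) - h (X i))) \<longlonglongrightarrow> 0"
    proof (rule AE_I2)
      fix z :: "real^'n"
      have "(\<lambda>i. s i *\<^sub>R z) \<longlonglongrightarrow> 0" using tendsto_scaleR[OF s tendsto_const[of z]] by simp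
      hence "(\<lambda>i. dist (X i + s i *\<^sub>R z) (X i)) \<longlonglongrightarrow> 0"
        unfolding dist_norm add_diff_cancel_left' by (rule tendsto_norm_zero)
      hence "(\<lambda>i. dist (h (X i + s i *\<^sub>R z)) (h (X i))) \<longlonglongrightarrow> 0"
        using u unfolding uniformly_continuous_on_sequentially by auto
      hence "(\<lambda>i. h (X i + s i *\<^sub>R z) - h (X i)) \<longlonglongrightarrow> 0"
        unfolding dist_norm by (rule tendsto_norm_zero_cancel)
      thus "(\<lambda>i. gauss_weight z * (h (X i + s i *\<^sub>R z) - h (X i))) \<longlonglongrightarrow> 0"
        by (rule tendsto_mult_right_zero)
    qed
    show "AE z in lborel. norm (gauss_weight z * (h (X i + s i *\<^sub>R z) - h (X i))) \<le> gauss_weight z * (2 * C)" for i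
    proof (rule AE_I2)
      fix z :: "real^'n"
      have "\<bar>h (X i + s i *\<^sub>R z) - h (X i)\<bar> \<le> 2 * C"
        using b[of "X i"] b[of "X i + s i *\<^sub>R z"] by linarith
      thus "norm (gauss_weight z * (h (X i + s i *\<^sub>R z) - h (X i))) \<le> gauss_weight z * (2 * C)"
        unfolding real_norm_def abs_mult abs_of_nonneg[OF gauss_weight_nonneg]
        by (intro mult_left_mono gauss_weight_nonneg)
    qed
    show "(\<lambda>z. gauss_weight z * (h (X i + s i *\<^sub>R z) - h (X i))) \<in> borel_measurable lborel" for i
      using borel_measurable_integrable[OF int[of "X i" "s i"]] borel_measurable_integrable[OF integrable_gauss_weight[where 'n = 'n]]
      unfolding right_diff_distrib by measurable
  qed simp
  hence "(\<lambda>i. dist (mollify (s i) h (X i)) (h (X i))) \<longlonglongrightarrow> 0"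
    unfolding dist_norm eq[symmetric] by (simp add: tendsto_rabs_zero)
  from order_tendstoD(2)[OF this e]
  show "\<forall>\<^sub>F i in sequentially. \<forall>x\<in>UNIV. dist (mollify (s i) h x) (h x) < e"
  proof (rule eventually_mono)
    fix i assume *: "dist (mollify (s i) h (X i)) (h (X i)) < e"
    show "\<forall>x\<in>UNIV. dist (mollify (s i) h x) (h x) < e"
    proof (intro ballI, rule ccontr)
      fix x assume "\<not> dist (mollify (s i) h x) (h x) < e"
      hence "e \<le> dist (mollify (s i) h x) (h x)" by simp
      hence "e \<le> dist (mollify (s i) h (X i)) (h (X i))" unfolding X_def by (rule someI)
      thus False using * by simp
    qed
  qed
qed

context OU_data
begin

text \<open>The identity writes \<open>P t f x\<close> as a constant plus an indefinite integral,
  which is continuous in its upper limit.\<close>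

lemma generator_identity_continuous:
  assumes "generator_identity f" shows "continuous_on {0..} (\<lambda>t. P t f x)"
proof -
  have c: "continuous_on {0..T} (\<lambda>t. P t f x)" for T
  proof (cases "0 \<le> T")
    case True
    have hi: "((\<lambda>s. L (P s f) x) has_integral (P t f x - f x)) {0..t}" if "0 \<le> t" for t
      using assms that by (auto simp: generator_identity_def)
    have "continuous_on {0..T} (\<lambda>t. f x + integral {0..t} (\<lambda>s. L (P s f) x))"
      by (intro continuous_intros indefinite_integral_continuous_1 has_integral_integrable[OF hi[OF True]])
    thus ?thesis by (rule continuous_on_eq) (use integral_unique[OF hi] in auto)
  qed auto
  show ?thesis
    unfolding continuous_on_eq_continuous_within
  proof
    fix t :: real assume t: "t \<in> {0..}"
    have "at t within {0..} = at t within {0..t + 1}"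
      by (rule at_within_nhd[of _ "{..<t + 1}"]) auto
    thus "continuous (at t within {0..}) (\<lambda>t. P t f x)"
      using c[of "t + 1"] t by (auto simp: continuous_on_eq_continuous_within)
  qed
qed

lemma P_const: "0 \<le> t \<Longrightarrow> P t (\<lambda>_. c) x = c"
  using prob_space.prob_space[OF law_facts(1)] by (simp add: OU_semigroup_def)

lemma P_diff_bound:
  assumes t: "0 \<le> t" and c: "continuous_on UNIV h" "continuous_on UNIV h'" "continuous_on UNIV e"
    and b: "\<And>x. \<bar>h x\<bar> \<le> C" "\<And>x. \<bar>h' x\<bar> \<le> C'" "\<And>x. \<bar>e x\<bar> \<le> C''"
    and d: "\<And>x. \<bar>h x - h' x\<bar> \<le> e x"
  shows "\<bar>P t h x - P t h' x\<bar> \<le> P t e x"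
proof -
  have int: "integrable (\<mu> t) (\<lambda>y. h (z + y))" "integrable (\<mu> t) (\<lambda>y. h' (z + y))" "integrable (\<mu> t) (\<lambda>y. e (z + y))" for z
    by (rule PV_integrable[OF t c(1), where C = C] PV_integrable[OF t c(2), where C = C'] PV_integrable[OF t c(3), where C = C''];
        use b in simp)+
  have "P t h x - P t h' x = (\<integral>y. h (E t *v x + y) - h' (E t *v x + y) \<partial>\<mu> t)"
    by (simp add: OU_semigroup_def int)
  also have "\<bar>\<dots>\<bar> \<le> (\<integral>y. \<bar>h (E t *v x + y) - h' (E t *v x + y)\<bar> \<partial>\<mu> t)"
    by (rule integral_abs_bound)
  also have "\<dots> \<le> (\<integral>y. e (E t *v x + y) \<partial>\<mu> t)"
    by (intro integral_mono integrable_abs Bochner_Integration.integrable_diff int d)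
  finally show ?thesis by (simp add: OU_semigroup_def)
qed

text \<open>The semigroup contracts the supremum norm at every time, so uniform approximation in
  space by mollifications is uniform in t as well, and continuity passes to the limit.\<close>

lemma continuous_P_uniformly_continuous:
  assumes h: "uniformly_continuous_on UNIV h" "\<And>x. \<bar>h x\<bar> \<le> C" "integrable lborel h"
  shows "continuous_on {0..} (\<lambda>t. P t h x)"
proof (rule uniform_limit_theorem[where F = sequentially and f = "\<lambda>i t. P t (mollify (1 / real (Suc i)) h) x"])
  have c: "continuous_on UNIV h" by (rule uniformly_continuous_imp_continuous[OF h(1)])
  have g: "generator_identity (mollify (1 / real (Suc i)) h)" for i
    by (rule generator_identity_mollify[OF h(3) c]) simp
  show "\<forall>\<^sub>F i in sequentially. continuous_on {0..} (\<lambda>t. P t (mollify (1 / real (Suc i)) h) x)"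
    by (intro always_eventually allI generator_identity_continuous g)
  show "uniform_limit {0..} (\<lambda>i t. P t (mollify (1 / real (Suc i)) h) x) (\<lambda>t. P t h x) sequentially"
  proof (rule uniform_limitI)
    fix e :: real assume e: "e > 0"
    have "(\<lambda>i. 1 / real (Suc i)) \<longlonglongrightarrow> 0" by real_asymp
    from uniform_limitD[OF mollify_uniform_limit[OF h(1,2) this], of "e / 2"] e
    have "\<forall>\<^sub>F i in sequentially. \<forall>x. dist (mollify (1 / real (Suc i)) h x) (h x) < e / 2" by simp
    thus "\<forall>\<^sub>F i in sequentially. \<forall>t\<in>{0..}. dist (P t (mollify (1 / real (Suc i)) h) x) (P t h x) < e"
    proof (rule eventually_mono, intro ballI)
      fix i and t :: real
      assume d: "\<forall>x. dist (mollify (1 / real (Suc i)) h x) (h x) < e / 2" and t: "t \<in> {0..}"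
      obtain C' g H where j: "C2_jet C' (mollify (1 / real (Suc i)) h) g H"
        using g unfolding generator_identity_def by blast
      have "\<bar>P t (mollify (1 / real (Suc i)) h) x - P t h x\<bar> \<le> P t (\<lambda>_. e / 2) x"
        by (rule P_diff_bound[OF _ C2_jetD(3)[OF j] c _ C2_jetD(6)[OF j] h(2), where C'' = "e / 2"])
           (use t e d in \<open>auto simp: dist_real_def intro: less_imp_le\<close>)
      also have "\<dots> < e" using t e by (simp add: P_const)
      finally show "dist (P t (mollify (1 / real (Suc i)) h) x) (P t h x) < e" by (simp add: dist_real_def)
    qed
  qed
qed auto

text \<open>Cutting \<open>g\<close> off by a wide Gaussian reduces to the uniformly continuous
  integrable case. The error is at most \<open>C\<close> times the defect
  \<open>1 - P t (G i) x\<close>, which is itself continuous in t because \<open>G i\<close>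
  satisfies the identity.\<close>

lemma continuous_P:
  assumes g: "continuous_on UNIV g" "\<And>x. \<bar>g x\<bar> \<le> C"
  shows "continuous_on {0..} (\<lambda>t. P t g x)"
  unfolding continuous_on
proof
  fix t0 :: real assume t0: "t0 \<in> {0..}"
  have C: "0 \<le> C" using g(2)[of 0] by linarith
  define c where "c i = 1 / real (Suc i)" for i
  have c: "c \<longlonglongrightarrow> 0" "c i \<noteq> 0" for i unfolding c_def by real_asymp auto
  define G where "G i z = gauss (c i *\<^sub>R z)" for i and z :: "real^'n"
  note jG = C2_jet_scaled_arg[OF C2_jet_gauss]
  have cG: "continuous_on UNIV (G i)" for i
    unfolding G_def[abs_def] by (rule C2_jetD(3)[OF jG])
  have gG: "generator_identity (G i)" for i
    unfolding G_def[abs_def] by (rule generator_identity_C2_jet[OF jG])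
  have G: "0 \<le> G i z" "G i z \<le> 1" for i z
    by (simp_all add: G_def gauss_le_1 less_imp_le[OF gauss_pos])
  \<comment> \<open>The tightness defect: it bounds, up to the factor \<open>C\<close>, the mass
    that the cut-off loses at time t.\<close>
  define r where "r i t = C * (1 - P t (G i) x)" for i t
  have Pr: "P t (\<lambda>z. C * (1 - G i z)) x = r i t" if "0 \<le> t" for i t
  proof -
    have "integrable (\<mu> t) (\<lambda>y. G i (z + y))" for z
      by (rule PV_integrable[OF that cG, where C = 1]) (use G in auto)
    thus ?thesis
      using prob_space.prob_space[OF law_facts(1)[OF that]] prob_space.finite_measure[OF law_facts(1)[OF that]]
      by (simp add: r_def OU_semigroup_def finite_measure.integrable_const)
  qed
  have bound: "\<bar>P t g x - P t (\<lambda>z. g z * G i z) x\<bar> \<le> r i t" if "0 \<le> t" for i t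
    unfolding Pr[OF that, symmetric]
  proof (rule P_diff_bound[OF that g(1) _ _ g(2), where C' = C and C'' = C])
    fix z
    have "\<bar>g z * G i z\<bar> \<le> C * 1" unfolding abs_mult using G[of i z] g(2)[of z] C by (intro mult_mono) auto
    thus "\<bar>g z * G i z\<bar> \<le> C" by simp
    have "C * (1 - G i z) \<le> C * 1" using G[of i z] C by (intro mult_left_mono) auto
    thus "\<bar>C * (1 - G i z)\<bar> \<le> C" using G[of i z] C by (simp add: abs_mult)
    have "g z - g z * G i z = g z * (1 - G i z)" by (simp add: algebra_simps)
    hence "\<bar>g z - g z * G i z\<bar> = \<bar>g z\<bar> * (1 - G i z)" using G[of i z] by (simp add: abs_mult)
    also have "\<dots> \<le> C * (1 - G i z)" using G[of i z] g(2)[of z] by (intro mult_right_mono) auto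
    finally show "\<bar>g z - g z * G i z\<bar> \<le> C * (1 - G i z)" .
  qed (intro continuous_intros g cG)+
  have cr: "continuous_on {0..} (r i)" for i
    unfolding r_def by (intro continuous_intros generator_identity_continuous gG)
  have cg: "continuous_on {0..} (\<lambda>t. P t (\<lambda>z. g z * G i z) x)" for i
  proof (rule continuous_P_uniformly_continuous)
    show "\<bar>g z * G i z\<bar> \<le> C" for z
    proof -
      have "\<bar>g z * G i z\<bar> \<le> C * 1" unfolding abs_mult using G[of i z] g(2)[of z] C by (intro mult_mono) auto
      thus ?thesis by simp
    qed
  qed (unfold G_def, rule mult_gauss_uniformly_continuous[OF g c(2)], rule integrable_mult_gauss_scaled[OF g c(2)])
  have "(\<lambda>i. P t0 (G i) x) \<longlonglongrightarrow> P t0 (\<lambda>_. 1) x"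
    unfolding P_eq_PV
  proof (rule PV_tendsto[where C = 1])
    show "(\<lambda>i. G i z) \<longlonglongrightarrow> 1" for z
    proof -
      have "(\<lambda>i. c i *\<^sub>R z) \<longlonglongrightarrow> 0" using tendsto_scaleR[OF c(1) tendsto_const[of z]] by simp
      from continuous_on_tendsto_compose[OF C2_jetD(3)[OF C2_jet_gauss] this]
      show ?thesis by (simp add: G_def gauss_def)
    qed
  qed (use t0 cG G in auto)
  from tendsto_mult_left[OF tendsto_diff[OF tendsto_const[of 1] this], of C]
  have r0: "(\<lambda>i. r i t0) \<longlonglongrightarrow> 0" using t0 by (simp add: r_def P_const)
  show "((\<lambda>t. P t g x) \<longlongrightarrow> P t0 g x) (at t0 within {0..})"
  proof (rule tendstoI)
    fix e :: real assume e: "e > 0"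
    \<comment> \<open>One \<open>i\<close> is fixed by looking at \<open>t0\<close> alone;
      continuity of \<open>r i\<close> keeps the defect small at nearby times. At \<open>t0\<close>
      the error is counted twice, hence the half of \<open>e\<close>.\<close>
    have "\<forall>\<^sub>F i in sequentially. r i t0 < e / 2" using order_tendstoD(2)[OF r0, of "e / 2"] e by simp
    then obtain i where i: "r i t0 < e / 2" by (auto simp: eventually_sequentially)
    let ?h = "\<lambda>t. P t (\<lambda>z. g z * G i z) x"
    have "((\<lambda>t. r i t + \<bar>?h t - ?h t0\<bar> + r i t0) \<longlongrightarrow> r i t0 + \<bar>?h t0 - ?h t0\<bar> + r i t0) (at t0 within {0..})"
      using cr[of i] cg[of i] t0 unfolding continuous_on by (intro tendsto_intros) auto
    hence "\<forall>\<^sub>F t in at t0 within {0..}. r i t + \<bar>?h t - ?h t0\<bar> + r i t0 < e"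
      by (rule order_tendstoD(2)) (use i in simp)
    moreover have "\<forall>\<^sub>F t in at t0 within {0..}. t \<in> {0..}"
      by (simp add: eventually_at_filter)
    ultimately show "\<forall>\<^sub>F t in at t0 within {0..}. dist (P t g x) (P t0 g x) < e"
    proof eventually_elim
      case (elim t)
      hence "0 \<le> t" "0 \<le> t0" using t0 by auto
      from bound[OF this(1), of i] bound[OF this(2), of i] elim(1)
      show ?case unfolding dist_real_def by linarith
    qed
  qed
qed

lemma PV_component: 
  fixes g :: "real^'n \<Rightarrow> 'b::{banach,second_countable_topology}"
  assumes "0 \<le> t" "continuous_on UNIV g" "\<And>x. norm (g x) \<le> C" "bounded_linear T"
  shows "PV t (\<lambda>x. T (g x)) x = T (PV t g x)"
  unfolding PV_def by (rule integral_bounded_linear[OF assms(4) PV_integrable[OF assms(1-3)]])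

lemma continuous_PV_vec:
  fixes g :: "real^'n \<Rightarrow> real^'m"
  assumes g: "continuous_on UNIV g" "\<And>x. norm (g x) \<le> C"
  shows "continuous_on {0..} (\<lambda>t. PV t g x)"
proof -
  have "continuous_on {0..} (\<lambda>t. PV t g x $ i)" for i
  proof (rule continuous_on_eq)
    show "continuous_on {0..} (\<lambda>t. P t (\<lambda>x. g x $ i) x)"
      by (rule continuous_P[where C = C])
         (auto intro!: continuous_intros g order_trans[OF component_le_norm_cart g(2)])
    show "P t (\<lambda>x. g x $ i) x = PV t g x $ i" if "t \<in> {0..}" for t
      using that PV_component[OF _ g bounded_linear_vec_nth] by (simp add: P_eq_PV)
  qed
  hence "continuous_on {0..} (\<lambda>t. \<chi> i. PV t g x $ i)" by (rule continuous_on_vec_lambda)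
  thus ?thesis by simp
qed

lemma continuous_PV_matrix:
  fixes g :: "real^'n \<Rightarrow> real^'m^'k"
  assumes g: "continuous_on UNIV g" "\<And>x. norm (g x) \<le> C"
  shows "continuous_on {0..} (\<lambda>t. PV t g x)"
proof -
  have "continuous_on {0..} (\<lambda>t. PV t g x $ i)" for i
  proof (rule continuous_on_eq)
    show "continuous_on {0..} (\<lambda>t. PV t (\<lambda>x. g x $ i) x)"
      by (rule continuous_PV_vec[where C = C])
         (auto intro!: continuous_intros g order_trans[OF Finite_Cartesian_Product.norm_nth_le g(2)])
    show "PV t (\<lambda>x. g x $ i) x = PV t g x $ i" if "t \<in> {0..}" for t
      using that PV_component[OF _ g bounded_linear_vec_nth] by simp
  qed
  hence "continuous_on {0..} (\<lambda>t. \<chi> i. PV t g x $ i)" by (rule continuous_on_vec_lambda)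
  thus ?thesis by simp
qed

text \<open>Along a convergent sequence of times the jets of \<open>P (X n) f\<close> share one
  constant, and their entries converge: \<open>continuous_P\<close> applies to \<open>f\<close> and,
  through components, to the gradient and to the merely continuous Hessian.\<close>

lemma continuous_LP:
  assumes j: "C2_jet C f g H"
  shows "continuous_on {0..} (\<lambda>t. L (P t f) x)"
  unfolding continuous_on_sequentially o_def
proof (intro ballI allI impI)
  fix X and t :: real assume t: "t \<in> {0..}" and "(\<forall>n. X n \<in> {0..}) \<and> X \<longlonglongrightarrow> t"
  hence X: "\<And>n. 0 \<le> X n" "X \<longlonglongrightarrow> t" by auto
  obtain T where T: "\<And>n. norm (X n) \<le> T"
    using convergent_imp_bounded[OF X(2)] by (auto simp: bounded_iff)
  obtain B where B: "B \<ge> 0" "\<And>s. s \<in> {0..T} \<Longrightarrow> (1 + norm (E s))\<^sup>2 \<le> B"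
    using P_bound_uniform by metis
  have jX: "C2_jet (C * B) (P (X n) f) (\<lambda>x. transpose (E (X n)) *v PV (X n) g x)
      (\<lambda>x. transpose (E (X n)) ** PV (X n) H x ** E (X n))" for n
  proof (rule C2_jet_mono[OF P_C2_jet[OF X(1) j]])
    have "X n \<in> {0..T}" using X(1)[of n] T[of n] by simp
    thus "C * (1 + norm (E (X n)))\<^sup>2 \<le> C * B" by (intro mult_left_mono B C2_jetD(9)[OF j])
  qed
  have seq: "(\<lambda>n. F (X n)) \<longlonglongrightarrow> F t" if "continuous_on {0..} F" for F :: "real \<Rightarrow> 'c::topological_space"
    using continuous_on_tendsto_compose[OF that X(2) t] X(1) by auto
  note d = C2_jetD[OF j]
  note lims = seq[OF continuous_matrix_exp]
  show "(\<lambda>n. L (P (X n) f) x) \<longlonglongrightarrow> L (P t f) x"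
  proof (rule L_tendsto[OF jX P_C2_jet[OF _ j]])
    show "(\<lambda>n. P (X n) f y) \<longlonglongrightarrow> P t f y" for y
      by (rule seq[OF continuous_P[OF d(3) d(6)]])
    show "(\<lambda>n. transpose (E (X n)) *v PV (X n) g x) \<longlonglongrightarrow> transpose (E t) *v PV t g x"
      by (intro bounded_bilinear.tendsto[OF bounded_bilinear_matrix_vector_mult]
          bounded_linear.tendsto[OF bounded_linear_transpose] lims seq[OF continuous_PV_vec[OF d(4) d(7)]])
    show "(\<lambda>n. transpose (E (X n)) ** PV (X n) H x ** E (X n)) \<longlonglongrightarrow> transpose (E t) ** PV t H x ** E t"
      by (intro bounded_bilinear.tendsto[OF bounded_bilinear_matrix_matrix_mult]
          bounded_linear.tendsto[OF bounded_linear_transpose] lims seq[OF continuous_PV_matrix[OF d(5) d(8)]])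
  qed (use t in auto)
qed

end

theorem theorem3p1:
  fixes A Q :: "real^'n^'n" and a :: "real^'n" and \<nu> :: "(real^'n) measure"
    and \<mu> :: "real \<Rightarrow> (real^'n) measure" and f :: "real^'n \<Rightarrow> real"
  assumes "symmetric_nonneg_definite Q"
    and "levy_measure \<nu>"
    and "\<And>t. 0 \<le> t \<Longrightarrow> OU_law A Q a \<nu> t (\<mu> t)"
    and "f \<in> Cb2"
  shows "(\<forall>x. continuous_on {0..} (\<lambda>t. OU_operator A Q a \<nu> (OU_semigroup A \<mu> t f) x) \<and>
            ((\<lambda>t. OU_operator A Q a \<nu> (OU_semigroup A \<mu> t f) x)
               \<longlongrightarrow> OU_operator A Q a \<nu> f x) (at_right 0)) \<and>
         (\<forall>x. \<forall>t\<ge>0. OU_semigroup A \<mu> t f x =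
            f x + integral {0..t} (\<lambda>s. OU_operator A Q a \<nu> (OU_semigroup A \<mu> s f) x))"
proof -
  interpret OU_data A Q a \<nu> \<mu> by standard (rule assms)+
  obtain C where j: "C2_jet C f (gradient f) (hessian f)" using C2_jet_Cb2[OF assms(4)] .
  have hi: "((\<lambda>s. L (P s f) x) has_integral (P t f x - f x)) {0..t}" if "0 \<le> t" for x t
    using generator_identity_C2_jet[OF j] that by (auto simp: generator_identity_def)
  have c: "continuous_on {0..} (\<lambda>t. L (P t f) x)" for x by (rule continuous_LP[OF j])
  \<comment> \<open>Read off from the identity at time 0, whose integral vanishes, instead of
    identifying \<open>\<mu> 0\<close> as the point mass at 0.\<close>
  have "P 0 f x = f x" for x
    using integral_unique[OF hi[of 0 x]] by simp
  hence P0: "P 0 f = f" by (rule ext)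
  have "((\<lambda>t. L (P t f) x) \<longlongrightarrow> L f x) (at_right 0)" for x
  proof -
    have "((\<lambda>t. L (P t f) x) \<longlongrightarrow> L (P 0 f) x) (at 0 within {0..})"
      using c[of x] unfolding continuous_on by auto
    hence "((\<lambda>t. L (P t f) x) \<longlongrightarrow> L (P 0 f) x) (at_right 0)"
      by (rule tendsto_within_subset) auto
    thus ?thesis by (simp only: P0)
  qed
  moreover have "P t f x = f x + integral {0..t} (\<lambda>s. L (P s f) x)" if "0 \<le> t" for x t
    using integral_unique[OF hi[OF that]] by simp
  ultimately show ?thesis using c by blast
qed

end
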